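(* Let $\mathcal{A}\subseteq[\mathbb{N}]^\omega$ be an almost disjoint family such that the ideal $\mathscr{X}(C_0(K_{\mathcal{A}}))$ of operators with separable range has finite codimension in $\mathscr{B}(C_0(K_{\mathcal{A}}))$. Then every algebra homomorphism from $\mathscr{B}(C_0(K_{\mathcal{A}}))$ into a Banach algebra is continuous.
   Context: $\mathbb{N}=\{0,1,2,\ldots\}$; $[\mathbb{N}]^\omega$ and $[\mathbb{N}]^{<\omega}$ denote the families of all infinite, respectively finite, subsets of $\mathbb{N}$. A family $\mathcal{A}\subseteq[\mathbb{N}]^\omega$ is almost disjoint if $A\cap A'$ is finite whenever $A,A'\in\mathcal{A}$ are distinct. The scalar field $\mathbb{K}$ is $\mathbb{R}$ or $\mathbb{C}$. For an almost disjoint family $\mathcal{A}$, $K_{\mathcal{A}}$ is the (locally compact, scattered, Hausdorff) topological space consisting of distinct points $\{x_n:n\in\mathbb{N}\}\cup\{y_A:A\in\mathcal{A}\}$, where each $x_n$ is isolated and, for each $A\in\mathcal{A}$, the sets $U(A,F)=\{x_n:n\in A\setminus F\}\cup\{y_A\}$ for $F\in[\mathbb{N}]^{<\omega}$ form a neighbourhood basis at $y_A$. For a locally compact Hausdorff space $K$, $C_0(K)$ is the Banach space of all continuous $f\colon K\to\mathbb{K}$ such that $\{x\in K:|f(x)|\ge\varepsilon\}$ is compact for each $\varepsilon>0$, with the supremum norm. For a Banach space $\mathcal{X}$, $\mathscr{B}(\mathcal{X})$ is the Banach algebra of all bounded linear operators on $\mathcal{X}$, and $\mathscr{X}(\mathcal{X})$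 is its closed two-sided ideal of operators with separable range. Algebra homomorphisms are linear and multiplicative, not assumed continuous. *)

theory Defs
  imports "HOL-Analysis.Analysis" "HOL-Library.Function_Algebras"
begin

section \<open>The space of an almost disjoint family\<close>

text \<open>\<open>Xpt n\<close> and \<open>Ypt A\<close> stand for \<open>x\<^sub>n\<close> and \<open>y\<^sub>A\<close>; points \<open>Ypt A\<close> with \<open>A \<notin> \<A>\<close> do not
  belong to the space of \<open>\<A>\<close>.\<close>

datatype psi_point = Xpt nat | Ypt "nat set"

definition psi_nhd :: "nat set \<Rightarrow> nat set \<Rightarrow> psi_point set" where
  "psi_nhd A F = Xpt ` (A - F) \<union> {Ypt A}"

definition psi_space :: "nat set set \<Rightarrow> psi_point topology" where
  "psi_space \<A> = topology (\<lambda>U. U \<subseteq> range Xpt \<union> Ypt ` \<A> \<and>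
     (\<forall>A. Ypt A \<in> U \<longrightarrow> (\<exists>F. finite F \<and> psi_nhd A F \<subseteq> U)))"

lemma openin_psi_space:
  "openin (psi_space \<A>) U \<longleftrightarrow> U \<subseteq> range Xpt \<union> Ypt ` \<A> \<and>
     (\<forall>A. Ypt A \<in> U \<longrightarrow> (\<exists>F. finite F \<and> psi_nhd A F \<subseteq> U))"
proof -
  have "istopology (\<lambda>U. U \<subseteq> range Xpt \<union> Ypt ` \<A> \<and>
     (\<forall>A. Ypt A \<in> U \<longrightarrow> (\<exists>F. finite F \<and> psi_nhd A F \<subseteq> U)))"
    unfolding istopology_def
  proof (rule conjI; clarify)
    fix S T
    assume S: "S \<subseteq> range Xpt \<union> Ypt ` \<A>"
        "\<forall>A. Ypt A \<in> S \<longrightarrow> (\<exists>F. finite F \<and> psi_nhd A F \<subseteq> S)"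
      and T: "\<forall>A. Ypt A \<in> T \<longrightarrow> (\<exists>F. finite F \<and> psi_nhd A F \<subseteq> T)"
    have "\<exists>F. finite F \<and> psi_nhd A F \<subseteq> S \<inter> T" if A: "Ypt A \<in> S \<inter> T" for A
    proof -
      obtain F G where "finite F" "psi_nhd A F \<subseteq> S" "finite G" "psi_nhd A G \<subseteq> T"
        using S(2) T A by blast
      then show ?thesis
        by (intro exI[of _ "F \<union> G"]) (auto simp: psi_nhd_def)
    qed
    then show "S \<inter> T \<subseteq> range Xpt \<union> Ypt ` \<A> \<and>
       (\<forall>A. Ypt A \<in> S \<inter> T \<longrightarrow> (\<exists>F. finite F \<and> psi_nhd A F \<subseteq> S \<inter> T))"
      using S(1) by blast
  next
    fix \<K>
    assume K: "\<forall>K\<in>\<K>. K \<subseteq> range Xpt \<union> Ypt ` \<A> \<and>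
       (\<forall>A. Ypt A \<in> K \<longrightarrow> (\<exists>F. finite F \<and> psi_nhd A F \<subseteq> K))"
    have "\<exists>F. finite F \<and> psi_nhd A F \<subseteq> \<Union>\<K>" if "Ypt A \<in> \<Union>\<K>" for A
      using K that by (meson Union_iff Union_upper subset_trans)
    moreover have "\<Union>\<K> \<subseteq> range Xpt \<union> Ypt ` \<A>"
      using K by (simp add: Sup_le_iff)
    ultimately show "\<Union>\<K> \<subseteq> range Xpt \<union> Ypt ` \<A> \<and>
       (\<forall>A. Ypt A \<in> \<Union>\<K> \<longrightarrow> (\<exists>F. finite F \<and> psi_nhd A F \<subseteq> \<Union>\<K>))"
      by blast
  qed
  then show ?thesis
    by (simp add: psi_space_def topology_inverse')
qed

lemma topspace_psi_space: "topspace (psi_space \<A>) = range Xpt \<union> Ypt ` \<A>"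
proof
  show "topspace (psi_space \<A>) \<subseteq> range Xpt \<union> Ypt ` \<A>"
    using openin_psi_space[of \<A> "topspace (psi_space \<A>)"] by simp
  have "openin (psi_space \<A>) (range Xpt \<union> Ypt ` \<A>)"
    unfolding openin_psi_space psi_nhd_def by auto
  then show "range Xpt \<union> Ypt ` \<A> \<subseteq> topspace (psi_space \<A>)"
    by (rule openin_subset)
qed

lemma openin_psi_space_Xpt: "openin (psi_space \<A>) {Xpt n}"
  by (auto simp: openin_psi_space)

lemma openin_psi_space_nhd: "A \<in> \<A> \<Longrightarrow> finite F \<Longrightarrow> openin (psi_space \<A>) (psi_nhd A F)"
  by (auto simp: openin_psi_space psi_nhd_def)


section \<open>The Banach space of continuous functions vanishing at infinity\<close>

text \<open>Functions and operators are total in HOL. They are required to vanish outside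
  their mathematical domain, so that equality of HOL functions is equality on that domain.\<close>

definition C0 :: "'p topology \<Rightarrow> ('p \<Rightarrow> 'k::real_normed_field) set" where
  "C0 K = {f. continuous_map K euclidean f \<and>
     (\<forall>\<epsilon>>0. compactin K {p \<in> topspace K. \<epsilon> \<le> norm (f p)}) \<and>
     (\<forall>p. p \<notin> topspace K \<longrightarrow> f p = 0)}"

definition sup_norm :: "'p topology \<Rightarrow> ('p \<Rightarrow> 'k::real_normed_field) \<Rightarrow> real" where
  "sup_norm K f = (SUP p\<in>topspace K. norm (f p))"

text \<open>The value \<open>0\<close> off the carrier is forced by the locale \<open>Metric_space\<close>, which
  demands symmetry and nonnegativity of the distance on the whole type.\<close>

definition C0_dist ::
  "'p topology \<Rightarrow> ('p \<Rightarrow> 'k::real_normed_field) \<Rightarrow> ('p \<Rightarrow> 'k) \<Rightarrow> real" where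
  "C0_dist K f g = (if f \<in> C0 K \<and> g \<in> C0 K then sup_norm K (f - g) else 0)"

definition C0_topology :: "'p topology \<Rightarrow> ('p \<Rightarrow> 'k::real_normed_field) topology" where
  "C0_topology K = Metric_space.mtopology (C0 K) (C0_dist K)"


section \<open>The Banach algebra of bounded operators\<close>

type_synonym ('p, 'k) operator = "('p \<Rightarrow> 'k) \<Rightarrow> ('p \<Rightarrow> 'k)"

definition bounded_ops :: "'p topology \<Rightarrow> ('p, 'k::real_normed_field) operator set" where
  "bounded_ops K = {T.
     (\<forall>f\<in>C0 K. T f \<in> C0 K) \<and>
     (\<forall>f\<in>C0 K. \<forall>g\<in>C0 K. T (f + g) = T f + T g) \<and>
     (\<forall>c. \<forall>f\<in>C0 K. T (\<lambda>p. c * f p) = (\<lambda>p. c * T f p)) \<and>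
     (\<exists>M. \<forall>f\<in>C0 K. sup_norm K (T f) \<le> M * sup_norm K f) \<and>
     (\<forall>f. f \<notin> C0 K \<longrightarrow> T f = 0)}"

definition op_scale ::
  "'k \<Rightarrow> ('p, 'k::real_normed_field) operator \<Rightarrow> ('p, 'k) operator" where
  "op_scale c T = (\<lambda>f p. c * T f p)"

definition op_norm :: "'p topology \<Rightarrow> ('p, 'k::real_normed_field) operator \<Rightarrow> real" where
  "op_norm K T = (SUP f\<in>{f \<in> C0 K. sup_norm K f \<le> 1}. sup_norm K (T f))"

definition op_dist ::
  "'p topology \<Rightarrow> ('p, 'k::real_normed_field) operator \<Rightarrow> ('p, 'k) operator \<Rightarrow> real" where
  "op_dist K S T = (if S \<in> bounded_ops K \<and> T \<in> bounded_ops K then op_norm K (S - T) else 0)"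

definition op_topology :: "'p topology \<Rightarrow> ('p, 'k::real_normed_field) operator topology" where
  "op_topology K = Metric_space.mtopology (bounded_ops K) (op_dist K)"

definition separable_range_ops ::
  "'p topology \<Rightarrow> ('p, 'k::real_normed_field) operator set" where
  "separable_range_ops K =
     {T \<in> bounded_ops K. separable_space (subtopology (C0_topology K) (T ` C0 K))}"

text \<open>\<open>V / W\<close> is finite-dimensional: it is spanned by the classes of finitely many
  elements of \<open>V\<close>.\<close>

definition finite_codim ::
  "('k::field \<Rightarrow> 'v::ab_group_add \<Rightarrow> 'v) \<Rightarrow> 'v set \<Rightarrow> 'v set \<Rightarrow> bool" where
  "finite_codim scl W V \<longleftrightarrow>
     (\<exists>B. finite B \<and> B \<subseteq> V \<and> (\<forall>v\<in>V. \<exists>u\<in>module.span scl B. v - u \<in> W))"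


section \<open>Banach algebras and homomorphisms\<close>

text \<open>Real Banach algebras, not necessarily unital, are the types of class
  \<open>{real_normed_algebra, banach}\<close>. A complex Banach algebra has in addition a
  complex scalar multiplication, compatible with product and norm, that extends the real one.\<close>

locale complex_banach_algebra = vector_space scl
  for scl :: "complex \<Rightarrow> 'b::{real_normed_algebra, banach} \<Rightarrow> 'b" +
  assumes scale_mult_left: "scl c x * y = scl c (x * y)"
    and scale_mult_right: "x * scl c y = scl c (x * y)"
    and norm_scale: "norm (scl c x) = cmod c * norm x"
    and scale_of_real: "scl (of_real r) x = r *\<^sub>R x"

definition algebra_hom ::
  "'p topology \<Rightarrow> ('k::real_normed_field \<Rightarrow> 'b::ring \<Rightarrow> 'b) \<Rightarrow>
   (('p, 'k) operator \<Rightarrow> 'b) \<Rightarrow> bool" where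
  "algebra_hom K scl \<theta> \<longleftrightarrow>
     (\<forall>S\<in>bounded_ops K. \<forall>T\<in>bounded_ops K. \<theta> (S + T) = \<theta> S + \<theta> T) \<and>
     (\<forall>c. \<forall>T\<in>bounded_ops K. \<theta> (op_scale c T) = scl c (\<theta> T)) \<and>
     (\<forall>S\<in>bounded_ops K. \<forall>T\<in>bounded_ops K. \<theta> (S \<circ> T) = \<theta> S * \<theta> T)"


section \<open>Well-definedness of the topologies and of the span\<close>

lemma vector_space_op_scale:
  "vector_space (op_scale :: 'k::real_normed_field \<Rightarrow> ('p, 'k) operator \<Rightarrow> ('p, 'k) operator)"
  by unfold_locales (auto simp: op_scale_def fun_eq_iff algebra_simps)

lemma zero_in_C0: "(0 :: 'p \<Rightarrow> 'k::real_normed_field) \<in> C0 K"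
  by (auto simp: C0_def zero_fun_def)

lemma C0_bounded:
  assumes "f \<in> C0 K"
  shows "bdd_above ((\<lambda>p. norm (f p)) ` topspace K)"
proof -
  let ?L = "{p \<in> topspace K. 1 \<le> norm (f p)}"
  have "compactin K ?L" "continuous_map K euclidean f"
    using assms by (auto simp: C0_def)
  then have "compact (f ` ?L)"
    using image_compactin by fastforce
  then obtain M where M: "\<And>p. p \<in> ?L \<Longrightarrow> norm (f p) \<le> M"
    by (force dest: compact_imp_bounded simp: bounded_iff)
  have "norm (f p) \<le> max M 1" if "p \<in> topspace K" for p
    using M[of p] that by (cases "1 \<le> norm (f p)") auto
  then show ?thesis
    by (auto intro!: bdd_aboveI)
qed

lemma C0_diff:
  assumes f: "f \<in> C0 K" and g: "g \<in> C0 K"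
  shows "f - g \<in> C0 K"
proof -
  have cont: "continuous_map K euclidean (f - g)"
    using f g unfolding C0_def fun_diff_def by (auto intro: continuous_map_diff)
  have "compactin K {p \<in> topspace K. e \<le> norm ((f - g) p)}" if "e > 0" for e
  proof (rule closed_compactin)
    show "compactin K ({p \<in> topspace K. e/2 \<le> norm (f p)} \<union> {p \<in> topspace K. e/2 \<le> norm (g p)})"
      using f g half_gt_zero[OF that] unfolding C0_def by (intro compactin_Un) blast+
    show "{p \<in> topspace K. e \<le> norm ((f - g) p)}
       \<subseteq> {p \<in> topspace K. e/2 \<le> norm (f p)} \<union> {p \<in> topspace K. e/2 \<le> norm (g p)}"
    proof clarsimp
      fix p assume "e \<le> norm (f p - g p)" "\<not> e \<le> norm (g p) * 2"
      then show "e \<le> norm (f p) * 2"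
        using norm_triangle_ineq4[of "f p" "g p"] by linarith
    qed
    have "closed {x. e \<le> norm (x :: 'b)}"
      by (intro closed_Collect_le continuous_intros)
    then show "closedin K {p \<in> topspace K. e \<le> norm ((f - g) p)}"
      using closedin_continuous_map_preimage[OF cont, of "{x. e \<le> norm x}"] by simp
  qed
  then show ?thesis
    using cont f g by (auto simp: C0_def)
qed

lemma C0_add:
  assumes "f \<in> C0 K" "g \<in> C0 K"
  shows "f + g \<in> C0 K"
  using C0_diff[OF assms(1) C0_diff[OF zero_in_C0 assms(2)]] by simp

lemma norm_le_sup_norm:
  "f \<in> C0 K \<Longrightarrow> p \<in> topspace K \<Longrightarrow> norm (f p) \<le> sup_norm K f"
  unfolding sup_norm_def by (rule cSUP_upper[OF _ C0_bounded])

lemma sup_norm_nonneg: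
  assumes "topspace K \<noteq> {}" "f \<in> C0 K"
  shows "0 \<le> sup_norm K f"
proof -
  obtain p where "p \<in> topspace K" using assms(1) by blast
  then show ?thesis
    using norm_le_sup_norm[OF assms(2)] norm_ge_zero order_trans by blast
qed

lemma sup_norm_minus_commute: "sup_norm K (f - g) = sup_norm K (g - f)"
  by (simp add: sup_norm_def norm_minus_commute)

lemma sup_norm_zero: "topspace K \<noteq> {} \<Longrightarrow> sup_norm K 0 = 0"
  by (simp add: sup_norm_def)

lemma C0_unit_ball_nonempty:
  assumes "topspace K \<noteq> {}"
  shows "{f \<in> C0 K. sup_norm K f \<le> 1} \<noteq> ({} :: ('p \<Rightarrow> 'k::real_normed_field) set)"
proof -
  have "(0 :: 'p \<Rightarrow> 'k) \<in> {f \<in> C0 K. sup_norm K f \<le> 1}"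
    by (simp add: zero_in_C0 sup_norm_zero[OF assms])
  then show ?thesis by blast
qed

lemma sup_norm_eq_0:
  assumes "topspace K \<noteq> {}" "f \<in> C0 K" "sup_norm K f \<le> 0"
  shows "f = 0"
proof
  fix p
  show "f p = 0 p"
  proof (cases "p \<in> topspace K")
    case True
    then have "norm (f p) \<le> 0"
      using norm_le_sup_norm[OF assms(2)] assms(3) order_trans by blast
    then show ?thesis by simp
  next
    case False
    then show ?thesis using assms(2) by (simp add: C0_def)
  qed
qed

lemma sup_norm_add:
  assumes "topspace K \<noteq> {}" "f \<in> C0 K" "g \<in> C0 K"
  shows "sup_norm K (f + g) \<le> sup_norm K f + sup_norm K g"
  unfolding sup_norm_def[of K "f + g"]
proof (rule cSUP_least[OF assms(1)])
  fix p assume "p \<in> topspace K"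
  then show "norm ((f + g) p) \<le> sup_norm K f + sup_norm K g"
    using norm_triangle_ineq[of "f p" "g p"] norm_le_sup_norm[of f K p]
      norm_le_sup_norm[of g K p] assms by simp
qed

lemma sup_norm_triangle:
  assumes "topspace K \<noteq> {}" "f \<in> C0 K" "g \<in> C0 K" "h \<in> C0 K"
  shows "sup_norm K (f - h) \<le> sup_norm K (f - g) + sup_norm K (g - h)"
  using sup_norm_add[OF assms(1), of "f - g" "g - h"] assms by (simp add: C0_diff)

lemma Metric_space_C0:
  assumes "topspace K \<noteq> {}"
  shows "Metric_space (C0 K) (C0_dist K)"
proof
  fix f g h :: "'a \<Rightarrow> 'b"
  show "0 \<le> C0_dist K f g"
    by (simp add: C0_dist_def C0_diff sup_norm_nonneg[OF assms])
  show "C0_dist K f g = C0_dist K g f"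
    by (auto simp: C0_dist_def sup_norm_minus_commute)
  show "C0_dist K f g = 0 \<longleftrightarrow> f = g" if "f \<in> C0 K" "g \<in> C0 K"
    using that assms sup_norm_eq_0[OF assms C0_diff[OF that]]
    by (auto simp: C0_dist_def sup_norm_zero)
  show "C0_dist K f h \<le> C0_dist K f g + C0_dist K g h"
    if "f \<in> C0 K" "g \<in> C0 K" "h \<in> C0 K"
    using that assms by (simp add: C0_dist_def sup_norm_triangle)
qed

lemma C0_scale:
  assumes "f \<in> C0 K"
  shows "(\<lambda>p. c * f p) \<in> C0 K"
proof (cases "c = 0")
  case True
  then show ?thesis using zero_in_C0[of K] by (simp add: zero_fun_def)
next
  case False
  have "continuous_map K euclidean (\<lambda>p. c * f p)"
    using assms continuous_map_compose[of K euclidean f euclidean "(*) c"]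
    by (auto simp: C0_def o_def intro: continuous_intros)
  moreover have "compactin K {p \<in> topspace K. e \<le> norm (c * f p)}" if "e > 0" for e
  proof -
    have "{p \<in> topspace K. e \<le> norm (c * f p)} = {p \<in> topspace K. e / norm c \<le> norm (f p)}"
      using False by (auto simp: norm_mult field_simps)
    then show ?thesis
      using assms False that by (simp add: C0_def)
  qed
  ultimately show ?thesis
    using assms by (auto simp: C0_def)
qed

lemma bounded_ops_diff:
  assumes K: "topspace K \<noteq> {}" and S: "S \<in> bounded_ops K" and T: "T \<in> bounded_ops K"
  shows "S - T \<in> bounded_ops K"
proof -
  obtain M N where M: "\<forall>f\<in>C0 K. sup_norm K (S f) \<le> M * sup_norm K f"
    and N: "\<forall>f\<in>C0 K. sup_norm K (T f) \<le> N * sup_norm K f"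
    using S T by (auto simp: bounded_ops_def)
  have "sup_norm K ((S - T) f) \<le> (M + N) * sup_norm K f" if f: "f \<in> C0 K" for f
  proof -
    have Sf: "S f \<in> C0 K" and Tf: "T f \<in> C0 K"
      using S T f by (auto simp: bounded_ops_def)
    have "sup_norm K (S f - T f) \<le> sup_norm K (S f) + sup_norm K (T f)"
      using sup_norm_triangle[OF K Sf zero_in_C0 Tf] sup_norm_minus_commute[of K 0 "T f"] by simp
    then show ?thesis
      using M N f by (force simp: algebra_simps)
  qed
  then have "\<exists>M. \<forall>f\<in>C0 K. sup_norm K ((S - T) f) \<le> M * sup_norm K f"
    by blast
  with S T show ?thesis
    by (simp add: bounded_ops_def C0_diff fun_eq_iff algebra_simps)
qed

lemma sup_norm_le_op_norm:
  assumes K: "topspace K \<noteq> {}" and T: "T \<in> bounded_ops K"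
    and f: "f \<in> C0 K" "sup_norm K f \<le> 1"
  shows "sup_norm K (T f) \<le> op_norm K T"
proof -
  obtain M where M: "\<forall>f\<in>C0 K. sup_norm K (T f) \<le> M * sup_norm K f"
    using T by (auto simp: bounded_ops_def)
  have "sup_norm K (T g) \<le> max M 0" if g: "g \<in> C0 K" "sup_norm K g \<le> 1" for g
  proof -
    have "M * sup_norm K g \<le> max M 0 * 1"
      using g sup_norm_nonneg[OF K g(1)] by (intro mult_mono) auto
    then show ?thesis using M g(1) by force
  qed
  then have "bdd_above ((\<lambda>f. sup_norm K (T f)) ` {f \<in> C0 K. sup_norm K f \<le> 1})"
    by (auto intro!: bdd_aboveI)
  then show ?thesis
    unfolding op_norm_def using f by (intro cSUP_upper) auto
qed

lemma op_norm_nonneg: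
  assumes K: "topspace K \<noteq> {}" and T: "T \<in> bounded_ops K"
  shows "0 \<le> op_norm K T"
proof -
  have "T 0 \<in> C0 K"
    using T zero_in_C0[of K] by (auto simp: bounded_ops_def)
  then show ?thesis
    using sup_norm_le_op_norm[OF K T zero_in_C0] sup_norm_nonneg[OF K] sup_norm_zero[OF K]
    by (metis order_trans zero_le_one)
qed

lemma op_norm_eq_0:
  assumes K: "topspace K \<noteq> {}" and T: "T \<in> bounded_ops K" and "op_norm K T \<le> 0"
  shows "T = 0"
proof
  fix f :: "'a \<Rightarrow> 'b"
  show "T f = 0 f"
  proof (cases "f \<in> C0 K")
    case f: True
    define c :: 'b where "c = of_real (inverse (1 + sup_norm K f))"
    have pos: "0 < 1 + sup_norm K f" using sup_norm_nonneg[OF K f] by simp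
    then have c: "c \<noteq> 0" "norm c = inverse (1 + sup_norm K f)"
      by (auto simp: c_def simp flip: of_real_inverse)
    have cf: "(\<lambda>p. c * f p) \<in> C0 K" by (rule C0_scale[OF f])
    have "norm (c * f p) \<le> 1" if "p \<in> topspace K" for p
      using norm_le_sup_norm[OF f that] pos by (simp add: norm_mult c field_simps)
    then have "sup_norm K (\<lambda>p. c * f p) \<le> 1"
      unfolding sup_norm_def by (intro cSUP_least[OF K])
    then have "sup_norm K (T (\<lambda>p. c * f p)) \<le> 0"
      using sup_norm_le_op_norm[OF K T cf] assms(3) by linarith
    moreover have "T (\<lambda>p. c * f p) \<in> C0 K"
      using T cf by (auto simp: bounded_ops_def)
    ultimately have "T (\<lambda>p. c * f p) = 0"
      using sup_norm_eq_0[OF K] by blast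
    then show ?thesis
      using T f c by (auto simp: bounded_ops_def fun_eq_iff)
  next
    case False
    then show ?thesis using T by (simp add: bounded_ops_def)
  qed
qed

lemma Metric_space_bounded_ops:
  assumes K: "topspace K \<noteq> {}"
  shows "Metric_space (bounded_ops K) (op_dist K)"
proof
  fix R S T :: "('a, 'b) operator"
  show "0 \<le> op_dist K S T"
    by (simp add: op_dist_def bounded_ops_diff[OF K] op_norm_nonneg[OF K])
  show "op_dist K S T = op_dist K T S"
  proof -
    have "op_norm K (S - T) = op_norm K (T - S)"
      unfolding op_norm_def by (intro SUP_cong) (simp_all add: sup_norm_def norm_minus_commute)
    then show ?thesis by (auto simp: op_dist_def)
  qed
  show "op_dist K S T = 0 \<longleftrightarrow> S = T" if ST: "S \<in> bounded_ops K" "T \<in> bounded_ops K"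
  proof -
    have "op_norm K (0 :: ('a, 'b) operator) = 0"
      by (simp add: op_norm_def sup_norm_zero[OF K] C0_unit_ball_nonempty[OF K] del: Collect_empty_eq)
    then show ?thesis
      using ST op_norm_eq_0[OF K bounded_ops_diff[OF K ST]] by (auto simp: op_dist_def)
  qed
  show "op_dist K R T \<le> op_dist K R S + op_dist K S T"
    if R: "R \<in> bounded_ops K" and S: "S \<in> bounded_ops K" and T: "T \<in> bounded_ops K"
  proof -
    have "op_norm K (R - T) \<le> op_norm K (R - S) + op_norm K (S - T)"
      unfolding op_norm_def[of K "R - T"]
    proof (rule cSUP_least)
      show "{f \<in> C0 K. sup_norm K f \<le> 1} \<noteq> ({} :: ('a \<Rightarrow> 'b) set)"
        by (rule C0_unit_ball_nonempty[OF K])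
      fix f :: "'a \<Rightarrow> 'b" assume f: "f \<in> {f \<in> C0 K. sup_norm K f \<le> 1}"
      then have "R f \<in> C0 K" "S f \<in> C0 K" "T f \<in> C0 K"
        using R S T by (auto simp: bounded_ops_def)
      then have "sup_norm K (R f - T f) \<le> sup_norm K (R f - S f) + sup_norm K (S f - T f)"
        by (rule sup_norm_triangle[OF K])
      then show "sup_norm K ((R - T) f) \<le> op_norm K (R - S) + op_norm K (S - T)"
        using sup_norm_le_op_norm[OF K bounded_ops_diff[OF K R S], of f]
          sup_norm_le_op_norm[OF K bounded_ops_diff[OF K S T], of f] f by simp
    qed
    then show ?thesis using R S T by (simp add: op_dist_def)
  qed
qed

end

theory Submission
  imports Defs
begin

text \<open>Every operator with separable range maps into the functions that vanish at \<open>y\<^sub>A\<close> for all \<open>A\<close>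
  outside some countable subfamily \<open>B\<close>. These functions form a copy of \<open>c\<^sub>0\<close>, and \<open>c\<^sub>0\<close> is
  complemented in the whole space. Suppose that the homomorphism \<open>\<theta>\<close> is unbounded on the operators
  of this kind. A sequence of witnesses can be taken with one common \<open>B\<close>, and since
  \<open>c\<^sub>0 \<cong> c\<^sub>0(\<nat> \<times> \<nat>)\<close> there are operators \<open>Q\<^sub>n\<close>, depending on \<open>B\<close> only, such that every norm-null
  sequence \<open>(R\<^sub>n)\<close> of operators for \<open>B\<close> is of the form \<open>R\<^sub>n = Q\<^sub>n S\<close> for one bounded \<open>S\<close>. Choosing the
  \<open>R\<^sub>n\<close> with \<open>\<parallel>\<theta>(R\<^sub>n)\<parallel> > n (1 + \<parallel>\<theta>(Q\<^sub>n)\<parallel>)\<close> forces \<open>\<parallel>\<theta>(S)\<parallel> > n\<close> for all \<open>n\<close>, which is absurd.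
  So \<open>\<theta>\<close> is bounded on a closed subspace of finite codimension, and hence everywhere.\<close>

section \<open>Bounded operators\<close>

lemma sup_norm_scale_le:
  assumes K: "topspace K \<noteq> {}" and f: "f \<in> C0 K"
  shows "sup_norm K (\<lambda>p. c * f p) \<le> norm c * sup_norm K f"
  unfolding sup_norm_def[of K "\<lambda>p. c * f p"]
  using norm_le_sup_norm[OF f] by (intro cSUP_least[OF K]) (simp add: norm_mult mult_left_mono)

lemma sup_norm_le:
  assumes "topspace K \<noteq> {}" "\<And>p. p \<in> topspace K \<Longrightarrow> norm (f p) \<le> M"
  shows "sup_norm K f \<le> M"
  unfolding sup_norm_def by (rule cSUP_least) (use assms in auto)

text \<open>Members of \<open>C0 K\<close> are \<open>0\<close> off \<open>topspace K\<close>, so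
  the bound survives there. Later estimates then need no membership test for points such as
  \<open>Ypt A0\<close>.\<close>

lemma norm_le_sup_norm_everywhere:
  assumes "topspace K \<noteq> {}" "f \<in> C0 K"
  shows "norm (f p) \<le> sup_norm K f"
proof (cases "p \<in> topspace K")
  case False
  then show ?thesis using sup_norm_nonneg[OF assms] assms(2) by (simp add: C0_def)
qed (rule norm_le_sup_norm[OF assms(2)])

lemma bounded_ops_C0: "T \<in> bounded_ops K \<Longrightarrow> f \<in> C0 K \<Longrightarrow> T f \<in> C0 K"
  by (simp add: bounded_ops_def)

lemma bounded_ops_zero: "T \<in> bounded_ops K \<Longrightarrow> T 0 = 0"
proof -
  assume "T \<in> bounded_ops K"
  then have "T (0 + 0) = T 0 + T 0"
    using zero_in_C0[of K] unfolding bounded_ops_def by blast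
  then show ?thesis by simp
qed

lemma sup_norm_le_op_norm_mult:
  assumes K: "topspace K \<noteq> {}" and T: "T \<in> bounded_ops K" and f: "f \<in> C0 K"
  shows "sup_norm K (T f) \<le> op_norm K T * sup_norm K f"
proof (cases "f = 0")
  case True
  then show ?thesis
    using bounded_ops_zero[OF T] by (simp add: sup_norm_zero[OF K])
next
  case False
  define s where "s = sup_norm K f"
  have s: "0 < s"
    using sup_norm_eq_0[OF K f] False unfolding s_def by (meson not_le)
  \<comment> \<open>Dividing by the norm moves \<open>f\<close> into the unit ball, over which
    \<open>op_norm\<close> is a supremum; the norm is positive because \<open>f\<close> is
    nonzero.\<close>
  define g where "g = (\<lambda>p. of_real (inverse s) * f p)"
  have g: "g \<in> C0 K" unfolding g_def by (rule C0_scale[OF f])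
  have "sup_norm K g \<le> 1"
    using sup_norm_scale_le[OF K f, of "of_real (inverse s)"] s
    by (simp add: g_def norm_inverse flip: s_def)
  then have le: "sup_norm K (T g) \<le> op_norm K T"
    by (rule sup_norm_le_op_norm[OF K T g])
  have "f = (\<lambda>p. of_real s * g p)"
    using s by (simp add: g_def flip: mult.assoc of_real_mult)
  then have "T f = (\<lambda>p. of_real s * T g p)"
    using T g by (simp add: bounded_ops_def)
  then have "sup_norm K (T f) \<le> s * sup_norm K (T g)"
    using sup_norm_scale_le[OF K bounded_ops_C0[OF T g], of "of_real s"] s by simp
  also have "\<dots> \<le> op_norm K T * s"
    using le s by (simp add: mult.commute)
  finally show ?thesis by (simp add: s_def)
qed

lemma op_norm_le:
  fixes T :: "('p, 'k::real_normed_field) operator"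
  assumes K: "topspace K \<noteq> {}"
    and M: "\<And>f. f \<in> C0 K \<Longrightarrow> sup_norm K f \<le> 1 \<Longrightarrow> sup_norm K (T f) \<le> M"
  shows "op_norm K T \<le> M"
  unfolding op_norm_def
  by (rule cSUP_least[OF C0_unit_ball_nonempty[OF K]]) (use M in auto)

lemma bounded_ops_zero_op: "topspace K \<noteq> {} \<Longrightarrow> 0 \<in> bounded_ops K"
  unfolding bounded_ops_def
  by (intro CollectI conjI ballI allI impI exI[of _ 0])
    (simp_all add: zero_in_C0 sup_norm_zero fun_eq_iff)

lemma bounded_ops_add:
  assumes K: "topspace K \<noteq> {}" and S: "S \<in> bounded_ops K" and T: "T \<in> bounded_ops K"
  shows "S + T \<in> bounded_ops K"
  using bounded_ops_diff[OF K S bounded_ops_diff[OF K bounded_ops_zero_op[OF K] T]] by simp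

lemma bounded_ops_scale:
  assumes K: "topspace K \<noteq> {}" and T: "T \<in> bounded_ops K"
  shows "op_scale c T \<in> bounded_ops K"
proof -
  have "sup_norm K (\<lambda>p. c * T f p) \<le> (norm c * op_norm K T) * sup_norm K f" if f: "f \<in> C0 K" for f
    using sup_norm_scale_le[OF K bounded_ops_C0[OF T f], of c]
      mult_left_mono[OF sup_norm_le_op_norm_mult[OF K T f] norm_ge_zero, of c]
    by (simp add: mult.assoc)
  then have "\<exists>M. \<forall>f\<in>C0 K. sup_norm K (op_scale c T f) \<le> M * sup_norm K f"
    by (auto simp: op_scale_def)
  then show ?thesis
    using T by (auto simp: bounded_ops_def op_scale_def fun_eq_iff algebra_simps C0_scale)
qed

lemma op_norm_scale_le:
  assumes K: "topspace K \<noteq> {}" and T: "T \<in> bounded_ops K"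
  shows "op_norm K (op_scale c T) \<le> norm c * op_norm K T"
proof (rule op_norm_le[OF K])
  fix f :: "'a \<Rightarrow> 'b" assume f: "f \<in> C0 K" "sup_norm K f \<le> 1"
  show "sup_norm K (op_scale c T f) \<le> norm c * op_norm K T"
    using sup_norm_scale_le[OF K bounded_ops_C0[OF T f(1)], of c]
      mult_left_mono[OF sup_norm_le_op_norm[OF K T f] norm_ge_zero, of c]
    by (simp add: op_scale_def)
qed

lemma op_norm_add_le:
  assumes K: "topspace K \<noteq> {}" and S: "S \<in> bounded_ops K" and T: "T \<in> bounded_ops K"
  shows "op_norm K (S + T) \<le> op_norm K S + op_norm K T"
proof (rule op_norm_le[OF K])
  fix f :: "'a \<Rightarrow> 'b" assume f: "f \<in> C0 K" "sup_norm K f \<le> 1"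
  show "sup_norm K ((S + T) f) \<le> op_norm K S + op_norm K T"
    using sup_norm_add[OF K bounded_ops_C0[OF S f(1)] bounded_ops_C0[OF T f(1)]]
      sup_norm_le_op_norm[OF K S f] sup_norm_le_op_norm[OF K T f] by simp
qed

section \<open>Seminorms and closed subspaces of finite codimension\<close>

text \<open>As \<open>W\<close> is closed, a vector \<open>b\<close> outside it has a positive
  distance \<open>d\<close> from \<open>W\<close>, so the coefficient of \<open>b\<close> is a
  bounded functional on \<open>W'\<close>. This controls \<open>p\<close> on \<open>W'\<close> and,
  by completeness of the scalars, makes \<open>W'\<close> closed again, so that the extension can be
  iterated.\<close>

lemma seminorm_bound_add_vector:
  fixes scl :: "'k::{real_normed_field, complete_space} \<Rightarrow> 'v::ab_group_add \<Rightarrow> 'v"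
    and N p :: "'v \<Rightarrow> real"
  assumes vs: "vector_space scl" and V: "module.subspace scl V"
    and N: "\<And>u v. u \<in> V \<Longrightarrow> v \<in> V \<Longrightarrow> N (u + v) \<le> N u + N v"
      "\<And>c v. v \<in> V \<Longrightarrow> N (scl c v) \<le> norm c * N v"
      "\<And>v. v \<in> V \<Longrightarrow> 0 \<le> N v"
    and p: "\<And>u v. u \<in> V \<Longrightarrow> v \<in> V \<Longrightarrow> p (u + v) \<le> p u + p v"
      "\<And>c v. v \<in> V \<Longrightarrow> p (scl c v) \<le> norm c * p v"
      "\<And>v. v \<in> V \<Longrightarrow> 0 \<le> p v"
    and W: "module.subspace scl W" "W \<subseteq> V"
    and closed: "\<And>v. v \<in> V \<Longrightarrow> (\<And>e. e > 0 \<Longrightarrow> \<exists>w\<in>W. N (v - w) < e) \<Longrightarrow> v \<in> W"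
    and bound: "\<And>w. w \<in> W \<Longrightarrow> p w \<le> C * N w" and C: "C \<ge> 0"
    and b: "b \<in> V"
  defines "W' \<equiv> {w + scl c b |w c. w \<in> W}"
  shows "\<And>v. v \<in> V \<Longrightarrow> (\<And>e. e > 0 \<Longrightarrow> \<exists>w\<in>W'. N (v - w) < e) \<Longrightarrow> v \<in> W'"
    and "\<exists>C'\<ge>0. \<forall>w\<in>W'. p w \<le> C' * N w"
proof -
  interpret vector_space scl by (rule vs)
  have minus: "N (u - v) \<le> N u + N v" if "u \<in> V" "v \<in> V" for u v
    using N(1)[of u "scl (-1) v"] N(2)[of v "-1"] that subspace_neg[OF V] by auto
  have "(\<forall>v. v \<in> V \<longrightarrow> (\<forall>e>0. \<exists>w\<in>W'. N (v - w) < e) \<longrightarrow> v \<in> W')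
      \<and> (\<exists>C'\<ge>0. \<forall>w\<in>W'. p w \<le> C' * N w)"
  proof (cases "b \<in> W")
    case True
    then have "W' \<subseteq> W"
      using subspace_add[OF W(1)] subspace_scale[OF W(1)] by (auto simp: W'_def)
    moreover have "w \<in> W'" if "w \<in> W" for w
      unfolding W'_def using that by (intro CollectI exI[of _ w] exI[of _ 0]) simp
    ultimately have "W' = W" by blast
    then show ?thesis using closed bound C by blast
  next
    case False
    then obtain d where d: "d > 0" "\<And>w. w \<in> W \<Longrightarrow> d \<le> N (b - w)"
      using closed[OF b] by (meson not_le)
    \<comment> \<open>After division by \<open>c\<close> the vector is the difference of
      \<open>b\<close> and a point of \<open>W\<close>.\<close>
    have coord: "norm c * d \<le> N (w + scl c b)" if w: "w \<in> W" for w c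
    proof (cases "c = 0")
      case True
      then show ?thesis using N(3) W w by auto
    next
      case c: False
      have wc: "- scl (inverse c) w \<in> W"
        using subspace_neg[OF W(1) subspace_scale[OF W(1) w]] by simp
      have V': "w + scl c b \<in> V"
        using V W w b by (auto simp: subspace_def)
      have "scl (inverse c) (w + scl c b) = b - (- scl (inverse c) w)"
        using c by (simp add: scale_right_distrib)
      then have "d \<le> norm (inverse c) * N (w + scl c b)"
        using d(2)[OF wc] N(2)[OF V', of "inverse c"] by simp
      then show ?thesis using c by (simp add: norm_divide inverse_eq_divide field_simps)
    qed
    \<comment> \<open>The constant combines three estimates: p(x) is at most C N(w) + |c| p(b), N(w)
      is at most N(x) + |c| N(b), and |c| is at most N(x) / d.\<close>
    have "p x \<le> (C + (C * N b + p b) / d) * N x" if x: "x \<in> W'" for x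
    proof -
      obtain w c where w: "w \<in> W" and x: "x = w + scl c b" using x by (auto simp: W'_def)
      have cb: "scl c b \<in> V" "x \<in> V" "w \<in> V" using V b W w x by (auto simp: subspace_def)
      have "norm c \<le> N x / d" using coord[OF w, of c] d(1) x by (simp add: field_simps)
      have "p x \<le> p w + norm c * p b"
        using p(1)[OF cb(3,1)] p(2)[OF b, of c] x by simp
      also have "p w \<le> C * (N x + norm c * N b)"
      proof -
        have "N w \<le> N x + norm c * N b"
          using minus[of x "scl c b"] N(2)[OF b, of c] cb x by simp
        then show ?thesis
          using bound[OF w] C by (meson mult_left_mono order_trans)
      qed
      also have "C * (N x + norm c * N b) + norm c * p b = C * N x + norm c * (C * N b + p b)"
        by (simp add: algebra_simps)
      also have "\<dots> \<le> C * N x + N x / d * (C * N b + p b)"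
        using \<open>norm c \<le> N x / d\<close> C N(3)[OF b] p(3)[OF b]
        by (intro add_left_mono mult_right_mono) auto
      finally show ?thesis by (simp add: algebra_simps add_divide_distrib)
    qed
    moreover have "0 \<le> C + (C * N b + p b) / d"
      using C d(1) N(3)[OF b] p(3)[OF b] by simp
    ultimately have part2: "\<exists>C'\<ge>0. \<forall>w\<in>W'. p w \<le> C' * N w" by blast
    have "v \<in> W'" if v: "v \<in> V" and app: "\<forall>e>0. \<exists>w\<in>W'. N (v - w) < e" for v
    proof -
      have "\<forall>n. \<exists>w c. w \<in> W \<and> N (v - (w + scl c b)) < inverse (real (Suc n))"
      proof
        fix n
        show "\<exists>w c. w \<in> W \<and> N (v - (w + scl c b)) < inverse (real (Suc n))"
          using app[rule_format, of "inverse (real (Suc n))"] by (fastforce simp: W'_def)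
      qed
      then obtain w c where w: "\<And>n. w n \<in> W"
        and lt: "\<And>n. N (v - (w n + scl (c n) b)) < inverse (real (Suc n))"
        by metis
      have inV: "w n + scl (c n) b \<in> V" "w n \<in> V" for n
        using V W(2) w[of n] b by (auto intro: subspace_add subspace_scale)
      \<comment> \<open>Applied to the difference of two approximants of \<open>v\<close>,
        \<open>coord\<close> bounds the difference of their coefficients.\<close>
      have diff: "norm (c m - c n) * d < inverse (real (Suc m)) + inverse (real (Suc n))" for m n
      proof -
        have "(w m - w n) + scl (c m - c n) b =
            (v - (w n + scl (c n) b)) - (v - (w m + scl (c m) b))"
          by (simp add: scale_left_diff_distrib algebra_simps)
        then have "N ((w m - w n) + scl (c m - c n) b) \<le>
            N (v - (w n + scl (c n) b)) + N (v - (w m + scl (c m) b))"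
          using minus[OF subspace_diff[OF V v inV(1)[of n]] subspace_diff[OF V v inV(1)[of m]]]
          by (simp only:)
        then show ?thesis
          using coord[OF subspace_diff[OF W(1) w[of m] w[of n]], of "c m - c n"] lt[of n] lt[of m] by linarith
      qed
      have "Cauchy c"
      proof (rule CauchyI)
        fix e :: real assume e: "0 < e"
        obtain M where M: "inverse (real (Suc M)) < e * d / 2"
          using reals_Archimedean[of "e * d / 2"] e d(1) by auto
        have "norm (c m - c n) < e" if "m \<ge> M" "n \<ge> M" for m n
        proof -
          have "inverse (real (Suc m)) \<le> inverse (real (Suc M))"
            "inverse (real (Suc n)) \<le> inverse (real (Suc M))"
            using that by auto
          then have "norm (c m - c n) * d < e * d" using diff[of m n] M by linarith
          then show ?thesis using d(1) by simp
        qed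
        then show "\<exists>M. \<forall>m\<ge>M. \<forall>n\<ge>M. norm (c m - c n) < e" by blast
      qed
      then obtain l where l: "c \<longlonglongrightarrow> l"
        by (auto simp: Cauchy_convergent_iff convergent_def)
      \<comment> \<open>With \<open>l\<close> the limit of the coefficients, the \<open>w n\<close>
        approach \<open>v - scl l b\<close>, and closedness of \<open>W\<close> applies.\<close>
      have "v - scl l b \<in> W"
      proof (rule closed)
        show "v - scl l b \<in> V" using V v b by (auto intro: subspace_diff subspace_scale)
        fix e :: real assume e: "e > 0"
        have "(\<lambda>n. inverse (real (Suc n)) + norm (c n - l) * N b) \<longlonglongrightarrow> 0 + norm (l - l) * N b"
          by (intro tendsto_intros l LIMSEQ_inverse_real_of_nat)
        then have "\<forall>\<^sub>F n in sequentially. inverse (real (Suc n)) + norm (c n - l) * N b < e"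
          using e by (intro order_tendstoD) auto
        then obtain n where n: "inverse (real (Suc n)) + norm (c n - l) * N b < e"
          by (auto simp: eventually_sequentially)
        have "v - scl l b - w n = (v - (w n + scl (c n) b)) + scl (c n - l) b"
          by (simp add: scale_left_diff_distrib algebra_simps)
        then have "N (v - scl l b - w n) \<le> N (v - (w n + scl (c n) b)) + N (scl (c n - l) b)"
          using N(1)[OF subspace_diff[OF V v inV(1)[of n]] subspace_scale[OF V b, of "c n - l"]]
          by (simp only:)
        then have "N (v - scl l b - w n) < e"
          using lt[of n] N(2)[OF b, of "c n - l"] n by linarith
        then show "\<exists>w\<in>W. N (v - scl l b - w) < e" using w by blast
      qed
      moreover have "v = (v - scl l b) + scl l b" by simp
      ultimately show "v \<in> W'" unfolding W'_def by blast
    qed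
    with part2 show ?thesis by blast
  qed
  then show "\<And>v. v \<in> V \<Longrightarrow> (\<And>e. e > 0 \<Longrightarrow> \<exists>w\<in>W'. N (v - w) < e) \<Longrightarrow> v \<in> W'"
    and "\<exists>C'\<ge>0. \<forall>w\<in>W'. p w \<le> C' * N w"
    by blast+
qed

text \<open>Induction on \<open>B\<close> with \<open>W\<close> arbitrary: each step moves one
  vector of \<open>B\<close> into \<open>W\<close>. Once \<open>B\<close> is empty its span is zero
  and \<open>W\<close> is all of \<open>V\<close>. The intended \<open>N\<close> is the operator
  norm, and \<open>p\<close> is the norm of the image under the homomorphism.\<close>

lemma seminorm_bound_finite_codim:
  fixes scl :: "'k::{real_normed_field, complete_space} \<Rightarrow> 'v::ab_group_add \<Rightarrow> 'v"
    and N p :: "'v \<Rightarrow> real"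
  assumes vs: "vector_space scl" and V: "module.subspace scl V"
    and N: "\<And>u v. u \<in> V \<Longrightarrow> v \<in> V \<Longrightarrow> N (u + v) \<le> N u + N v"
      "\<And>c v. v \<in> V \<Longrightarrow> N (scl c v) \<le> norm c * N v"
      "\<And>v. v \<in> V \<Longrightarrow> 0 \<le> N v"
    and p: "\<And>u v. u \<in> V \<Longrightarrow> v \<in> V \<Longrightarrow> p (u + v) \<le> p u + p v"
      "\<And>c v. v \<in> V \<Longrightarrow> p (scl c v) \<le> norm c * p v"
      "\<And>v. v \<in> V \<Longrightarrow> 0 \<le> p v"
    and "module.subspace scl W" "W \<subseteq> V"
    and "\<And>v. v \<in> V \<Longrightarrow> (\<And>e. e > 0 \<Longrightarrow> \<exists>w\<in>W. N (v - w) < e) \<Longrightarrow> v \<in> W"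
    and "\<exists>C\<ge>0. \<forall>w\<in>W. p w \<le> C * N w"
    and "finite B" "B \<subseteq> V" and "\<forall>v\<in>V. \<exists>u\<in>module.span scl B. v - u \<in> W"
  shows "\<exists>C\<ge>0. \<forall>v\<in>V. p v \<le> C * N v"
proof -
  interpret vector_space scl by (rule vs)
  show ?thesis
    using assms(13,9-12,14-)
  proof (induction B arbitrary: W rule: finite_induct)
    case empty
    then have "V \<subseteq> W" by auto
    then show ?case using empty by blast
  next
    case (insert b B)
    define W' where "W' = {w + scl c b |w c. w \<in> W}"
    obtain C where C: "C \<ge> 0" "\<And>w. w \<in> W \<Longrightarrow> p w \<le> C * N w"
      using insert.prems(4) by blast
    have b: "b \<in> V" using insert.prems by blast
    note step = seminorm_bound_add_vector[of scl V N p, OF vs V N p insert.prems(1-3) C(2,1) b,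
        folded W'_def]
    show ?case
    proof (rule insert.IH[of W'])
      have "W' = {x + y |x y. x \<in> W \<and> y \<in> span {b}}"
        by (auto simp: W'_def span_singleton)
      then show "subspace W'"
        using subspace_sums[OF insert.prems(1) subspace_span, of "{b}"] by simp
      show "W' \<subseteq> V"
        using insert.prems(2) b V by (auto simp: W'_def intro!: subspace_add subspace_scale)
      show "v \<in> W'" if "v \<in> V" "\<And>e. e > 0 \<Longrightarrow> \<exists>w\<in>W'. N (v - w) < e" for v
        by (rule step(1)) (use that in auto)
      show "\<exists>C\<ge>0. \<forall>w\<in>W'. p w \<le> C * N w" by (rule step(2)) auto
      show "B \<subseteq> V" using insert.prems by blast
      show "\<forall>v\<in>V. \<exists>u\<in>span B. v - u \<in> W'"
      proof
        fix v assume "v \<in> V"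
        then obtain u where u: "u \<in> span (insert b B)" "v - u \<in> W"
          using insert.prems(6) by blast
        then obtain k where k: "u - scl k b \<in> span B"
          by (auto simp: span_insert)
        \<comment> \<open>The multiple of \<open>b\<close> contained in \<open>u\<close> is shifted
          to the other side, which enlarges \<open>W\<close> to \<open>W'\<close>.\<close>
        have "v - (u - scl k b) = (v - u) + scl k b" by simp
        then show "\<exists>u\<in>span B. v - u \<in> W'"
          using u(2) k unfolding W'_def by blast
      qed
    qed
  qed
qed

section \<open>Continuous functions on the space of an almost disjoint family\<close>

lemma Ypt_mem_psi_nhd [simp]: "Ypt A \<in> psi_nhd B F \<longleftrightarrow> A = B"
  by (auto simp: psi_nhd_def)

lemma Xpt_mem_psi_nhd [simp]: "Xpt n \<in> psi_nhd A F \<longleftrightarrow> n \<in> A - F"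
  by (auto simp: psi_nhd_def)

lemma psi_space_nontrivial [simp]: "psi_space \<A> \<noteq> trivial_topology"
  using topspace_psi_space[of \<A>] by force

lemma Xpt_in_topspace [simp]: "Xpt n \<in> topspace (psi_space \<A>)"
  by (simp add: topspace_psi_space)

lemma Ypt_in_topspace [simp]: "Ypt A \<in> topspace (psi_space \<A>) \<longleftrightarrow> A \<in> \<A>"
  by (auto simp: topspace_psi_space)

text \<open>The points \<open>Xpt n\<close> are isolated, so continuity is a condition at the points
  \<open>Ypt A\<close> only: convergence of the values along \<open>A\<close>.\<close>

lemma continuous_map_psi_space:
  fixes f :: "psi_point \<Rightarrow> 'k::metric_space"
  shows "continuous_map (psi_space \<A>) euclidean f \<longleftrightarrow>
    (\<forall>A\<in>\<A>. \<forall>e>0. finite {n\<in>A. e \<le> dist (f (Xpt n)) (f (Ypt A))})"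
proof (intro iffI ballI allI impI)
  fix A and e :: real
  assume f: "continuous_map (psi_space \<A>) euclidean f" and A: "A \<in> \<A>" and e: "e > 0"
  have "openin (psi_space \<A>) {p \<in> topspace (psi_space \<A>). f p \<in> ball (f (Ypt A)) e}"
    using f by (auto simp: continuous_map_def)
  then obtain F where F: "finite F"
    "psi_nhd A F \<subseteq> {p \<in> topspace (psi_space \<A>). f p \<in> ball (f (Ypt A)) e}"
    using A e unfolding openin_psi_space by force
  have "n \<in> F" if "n \<in> A" "e \<le> dist (f (Xpt n)) (f (Ypt A))" for n
    using F(2) that by (force simp: dist_commute psi_nhd_def)
  then have "{n\<in>A. e \<le> dist (f (Xpt n)) (f (Ypt A))} \<subseteq> F" by blast
  then show "finite {n\<in>A. e \<le> dist (f (Xpt n)) (f (Ypt A))}"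
    using F(1) finite_subset by blast
next
  assume fin: "\<forall>A\<in>\<A>. \<forall>e>0. finite {n\<in>A. e \<le> dist (f (Xpt n)) (f (Ypt A))}"
  have "openin (psi_space \<A>) {p \<in> topspace (psi_space \<A>). f p \<in> U}" if U: "open U" for U
    unfolding openin_psi_space
  proof (intro conjI allI impI)
    show "{p \<in> topspace (psi_space \<A>). f p \<in> U} \<subseteq> range Xpt \<union> Ypt ` \<A>"
      by (auto simp: topspace_psi_space)
    fix A assume "Ypt A \<in> {p \<in> topspace (psi_space \<A>). f p \<in> U}"
    then have A: "A \<in> \<A>" and AU: "f (Ypt A) \<in> U" by auto
    obtain e where e: "e > 0" "\<And>y. dist y (f (Ypt A)) < e \<Longrightarrow> y \<in> U"
      using U AU unfolding open_dist by blast
    define F where "F = {n\<in>A. e \<le> dist (f (Xpt n)) (f (Ypt A))}"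
    have "finite F" using fin A e(1) by (simp add: F_def)
    moreover have "psi_nhd A F \<subseteq> {p \<in> topspace (psi_space \<A>). f p \<in> U}"
      using A AU e(2) by (auto simp: psi_nhd_def F_def not_le)
    ultimately show "\<exists>F. finite F \<and> psi_nhd A F \<subseteq> {p \<in> topspace (psi_space \<A>). f p \<in> U}"
      by blast
  qed
  then show "continuous_map (psi_space \<A>) euclidean f"
    by (auto simp: continuous_map_def)
qed

text \<open>This set resembles a one-point compactification of the discrete set \<open>A\<close>: a
  member of the cover that contains \<open>Ypt A\<close> misses only finitely many of its
  points.\<close>

lemma compactin_psi_nhd:
  assumes "A \<in> \<A>"
  shows "compactin (psi_space \<A>) (psi_nhd A {})"
  unfolding compactin_def
proof (intro conjI allI impI)
  show "psi_nhd A {} \<subseteq> topspace (psi_space \<A>)"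
    using assms by (auto simp: psi_nhd_def)
  fix \<U> assume U: "(\<forall>U\<in>\<U>. openin (psi_space \<A>) U) \<and> psi_nhd A {} \<subseteq> \<Union>\<U>"
  moreover have "Ypt A \<in> psi_nhd A {}" by simp
  ultimately obtain V where "V \<in> \<U>" "Ypt A \<in> V" "openin (psi_space \<A>) V"
    by (meson UnionE subsetD)
  then obtain F where V: "V \<in> \<U>" "finite F" "psi_nhd A F \<subseteq> V"
    by (auto simp: openin_psi_space)
  have "compactin (psi_space \<A>) (Xpt ` (A \<inter> F))"
    by (rule finite_imp_compactin) (use V(2) in auto)
  moreover have "Xpt ` (A \<inter> F) \<subseteq> psi_nhd A {}" by (auto simp: psi_nhd_def)
  then have "Xpt ` (A \<inter> F) \<subseteq> \<Union>\<U>" using U by (meson order_trans)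
  ultimately obtain \<F> where \<F>: "finite \<F>" "\<F> \<subseteq> \<U>" "Xpt ` (A \<inter> F) \<subseteq> \<Union>\<F>"
    using U unfolding compactin_def by meson
  have "psi_nhd A {} \<subseteq> psi_nhd A F \<union> Xpt ` (A \<inter> F)" by (auto simp: psi_nhd_def)
  then have "psi_nhd A {} \<subseteq> \<Union>(insert V \<F>)"
    using V(3) \<F>(3) by (simp add: subset_iff) blast
  then show "\<exists>\<F>. finite \<F> \<and> \<F> \<subseteq> \<U> \<and> psi_nhd A {} \<subseteq> \<Union>\<F>"
    using V(1) \<F>(1,2) by (intro exI[of _ "insert V \<F>"]) simp
qed

lemma compactin_psi_space_cover:
  assumes "compactin (psi_space \<A>) L"
  shows "\<exists>F \<G>. finite F \<and> finite \<G> \<and> \<G> \<subseteq> \<A> \<and> L \<subseteq> Xpt ` F \<union> (\<Union>A\<in>\<G>. psi_nhd A {})"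
proof -
  let ?\<U> = "(\<lambda>n. {Xpt n}) ` UNIV \<union> (\<lambda>A. psi_nhd A {}) ` \<A>"
  have "\<forall>U\<in>?\<U>. openin (psi_space \<A>) U"
    by (auto simp: openin_psi_space_Xpt openin_psi_space_nhd)
  moreover have "L \<subseteq> \<Union>?\<U>"
    using compactin_subset_topspace[OF assms] by (auto simp: topspace_psi_space psi_nhd_def)
  ultimately obtain \<F> where \<F>: "finite \<F>" "\<F> \<subseteq> ?\<U>" "L \<subseteq> \<Union>\<F>"
    using assms unfolding compactin_def by meson
  obtain \<F>1 \<F>2 where \<F>12: "\<F> = \<F>1 \<union> \<F>2" "\<F>1 \<subseteq> (\<lambda>n. {Xpt n}) ` UNIV" "\<F>2 \<subseteq> (\<lambda>A. psi_nhd A {}) ` \<A>"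
    using \<F>(2) unfolding subset_Un_eq[symmetric] by (meson subset_UnE)
  have fin: "finite \<F>1" "finite \<F>2" using \<F>(1) \<F>12(1) by auto
  obtain F where F: "finite F" "\<F>1 = (\<lambda>n. {Xpt n}) ` F"
    using finite_subset_image[OF fin(1) \<F>12(2)] by blast
  obtain \<G> where "\<G> \<subseteq> \<A>" "finite \<G>" "\<F>2 = (\<lambda>A. psi_nhd A {}) ` \<G>"
    using finite_subset_image[OF fin(2) \<F>12(3)] by blast
  with F \<F>(3) \<F>12(1) show ?thesis
    by (intro exI[of _ F] exI[of _ \<G>]) auto
qed

text \<open>Level sets of a continuous function are closed, and every compact set lies in a compact
  union of a finite set and finitely many \<open>psi_nhd A {}\<close>; so compactness of a level set
  means being covered by such a union. Membership in \<open>C0\<close> thereby becomes a matter of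
  finite index sets.\<close>

lemma C0_psi_space_iff:
  fixes f :: "psi_point \<Rightarrow> 'k::real_normed_field"
  shows "f \<in> C0 (psi_space \<A>) \<longleftrightarrow>
    (\<forall>A\<in>\<A>. \<forall>e>0. finite {n\<in>A. e \<le> norm (f (Xpt n) - f (Ypt A))}) \<and>
    (\<forall>e>0. \<exists>F \<G>. finite F \<and> finite \<G> \<and> \<G> \<subseteq> \<A> \<and>
      {p \<in> topspace (psi_space \<A>). e \<le> norm (f p)} \<subseteq> Xpt ` F \<union> (\<Union>A\<in>\<G>. psi_nhd A {})) \<and>
    (\<forall>p. p \<notin> topspace (psi_space \<A>) \<longrightarrow> f p = 0)" (is "_ \<longleftrightarrow> ?cont \<and> ?van \<and> ?supp")
proof -
  let ?K = "psi_space \<A>"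
  have "compactin ?K {p \<in> topspace ?K. e \<le> norm (f p)} \<longleftrightarrow>
      (\<exists>F \<G>. finite F \<and> finite \<G> \<and> \<G> \<subseteq> \<A> \<and>
        {p \<in> topspace ?K. e \<le> norm (f p)} \<subseteq> Xpt ` F \<union> (\<Union>A\<in>\<G>. psi_nhd A {}))"
    if f: "continuous_map ?K euclidean f" for e
  proof
    assume "\<exists>F \<G>. finite F \<and> finite \<G> \<and> \<G> \<subseteq> \<A> \<and>
        {p \<in> topspace ?K. e \<le> norm (f p)} \<subseteq> Xpt ` F \<union> (\<Union>A\<in>\<G>. psi_nhd A {})"
    then obtain F \<G> where FG: "finite F" "finite \<G>" "\<G> \<subseteq> \<A>"
      "{p \<in> topspace ?K. e \<le> norm (f p)} \<subseteq> Xpt ` F \<union> (\<Union>A\<in>\<G>. psi_nhd A {})" by blast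
    have "compactin ?K (Xpt ` F)"
      by (rule finite_imp_compactin) (use FG(1) in auto)
    moreover have "compactin ?K (\<Union>A\<in>\<G>. psi_nhd A {})"
      using FG compactin_psi_nhd[of _ \<A>] by (intro compactin_Union) auto
    ultimately have "compactin ?K (Xpt ` F \<union> (\<Union>A\<in>\<G>. psi_nhd A {}))"
      by (rule compactin_Un)
    moreover have "closed {x. e \<le> norm (x :: 'k)}"
      by (intro closed_Collect_le continuous_intros)
    then have "closedin ?K {p \<in> topspace ?K. e \<le> norm (f p)}"
      using closedin_continuous_map_preimage[OF f, of "{x. e \<le> norm x}"] by simp
    ultimately show "compactin ?K {p \<in> topspace ?K. e \<le> norm (f p)}"
      using FG(4) closed_compactin by blast
  qed (rule compactin_psi_space_cover)
  moreover have "continuous_map ?K euclidean f \<longleftrightarrow> ?cont"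
    by (simp add: continuous_map_psi_space dist_norm)
  ultimately show ?thesis
    unfolding C0_def mem_Collect_eq by (cases ?cont) simp_all
qed

lemma C0_psi_space_Ypt_outside: "f \<in> C0 (psi_space \<A>) \<Longrightarrow> A \<notin> \<A> \<Longrightarrow> f (Ypt A) = 0"
  by (simp add: C0_def)

lemma C0_psi_space_finite_Ypt:
  assumes "f \<in> C0 (psi_space \<A>)" "e > 0"
  shows "finite {A. e \<le> norm (f (Ypt A))}"
proof -
  obtain F \<G> where "finite \<G>" and
    sub: "{p \<in> topspace (psi_space \<A>). e \<le> norm (f p)} \<subseteq> Xpt ` F \<union> (\<Union>A\<in>\<G>. psi_nhd A {})"
    using assms unfolding C0_psi_space_iff by meson
  have "A \<in> \<G>" if "e \<le> norm (f (Ypt A))" for A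
  proof -
    have "f (Ypt A) \<noteq> 0" using that assms(2) by auto
    then have "Ypt A \<in> topspace (psi_space \<A>)"
      using C0_psi_space_Ypt_outside[OF assms(1)] by auto
    then have "Ypt A \<in> Xpt ` F \<union> (\<Union>A\<in>\<G>. psi_nhd A {})" using sub that by blast
    then show ?thesis by auto
  qed
  then have "{A. e \<le> norm (f (Ypt A))} \<subseteq> \<G>" by blast
  then show ?thesis using \<open>finite \<G>\<close> finite_subset by blast
qed

lemma C0_psi_space_countable_Ypt:
  assumes "f \<in> C0 (psi_space \<A>)"
  shows "countable {A. f (Ypt A) \<noteq> 0}"
proof -
  have "{A. f (Ypt A) \<noteq> 0} \<subseteq> (\<Union>n. {A. inverse (real (Suc n)) \<le> norm (f (Ypt A))})"
  proof
    fix A assume "A \<in> {A. f (Ypt A) \<noteq> 0}"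
    then obtain n where "inverse (real (Suc n)) < norm (f (Ypt A))"
      using reals_Archimedean[of "norm (f (Ypt A))"] by auto
    then show "A \<in> (\<Union>n. {A. inverse (real (Suc n)) \<le> norm (f (Ypt A))})"
      by (auto intro: less_imp_le)
  qed
  moreover have "countable (\<Union>n. {A. inverse (real (Suc n)) \<le> norm (f (Ypt A))})"
    using C0_psi_space_finite_Ypt[OF assms] by (intro countable_UN) (auto intro: countable_finite)
  ultimately show ?thesis by (rule countable_subset)
qed

text \<open>The space c_0(S), with functions extended by zero to the whole type so that the
  finiteness condition can range over all points.\<close>

definition c0_on :: "'i set \<Rightarrow> ('i \<Rightarrow> 'k::real_normed_field) set" where
  "c0_on S = {g. (\<forall>e>0. finite {p. e \<le> norm (g p)}) \<and> (\<forall>p. p \<notin> S \<longrightarrow> g p = 0)}"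

lemma c0_on_Xpt_subset_C0:
  assumes "g \<in> c0_on (range Xpt)"
  shows "g \<in> C0 (psi_space \<A>)"
proof -
  have fin: "finite {n. e \<le> norm (g (Xpt n))}" if "e > 0" for e
  proof -
    have "finite {p. e \<le> norm (g p)}" using assms that by (simp add: c0_on_def)
    then have "finite (Xpt -` {p. e \<le> norm (g p)})"
      by (rule finite_vimageI) (simp add: inj_on_def)
    then show ?thesis by (simp add: vimage_def)
  qed
  have Y: "g (Ypt A) = 0" for A
    using assms by (auto simp: c0_on_def)
  show ?thesis
    unfolding C0_psi_space_iff
  proof (intro conjI ballI allI impI)
    fix A and e :: real assume "e > 0"
    then show "finite {n \<in> A. e \<le> norm (g (Xpt n) - g (Ypt A))}"
      using fin[of e] by (simp add: Y)
  next
    fix e :: real assume e: "e > 0"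
    have "p \<in> Xpt ` {n. e \<le> norm (g (Xpt n))}" if "e \<le> norm (g p)" for p
      using that e by (cases p) (auto simp: Y)
    then show "\<exists>F \<G>. finite F \<and> finite \<G> \<and> \<G> \<subseteq> \<A> \<and>
        {p \<in> topspace (psi_space \<A>). e \<le> norm (g p)} \<subseteq> Xpt ` F \<union> (\<Union>A\<in>\<G>. psi_nhd A {})"
      using fin[OF e] by (intro exI[of _ "{n. e \<le> norm (g (Xpt n))}"] exI[of _ "{}"]) auto
  next
    fix p assume "p \<notin> topspace (psi_space \<A>)"
    then show "g p = 0" by (cases p) (auto simp: Y)
  qed
qed

section \<open>The functions living on a countable subfamily form a copy of \<open>c\<^sub>0\<close>\<close>

text \<open>The function \<open>r\<close> sends \<open>j\<close> to the first \<open>A \<in> B\<close> containing \<open>j\<close>, and to the junk value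
  \<open>{} \<notin> B\<close> if there is none; its fibres make the members of \<open>B\<close> disjoint at the cost of finitely
  many points of each.\<close>

lemma countable_disjointification:
  assumes "countable B" "{} \<notin> B" and ad: "pairwise (\<lambda>A A'. finite (A \<inter> A')) B"
  obtains r :: "nat \<Rightarrow> nat set"
  where "\<And>j. r j \<in> B \<Longrightarrow> j \<in> r j" "\<And>A. A \<in> B \<Longrightarrow> finite {j\<in>A. r j \<noteq> A}"
proof
  define e where "e = to_nat_on B"
  have e: "inj_on e B" unfolding e_def by (rule inj_on_to_nat_on[OF assms(1)])
  define m where "m j = arg_min e (\<lambda>A. A \<in> B \<and> j \<in> A)" for j
  have m: "m j \<in> B" "j \<in> m j" "e (m j) \<le> e A" if "A \<in> B" "j \<in> A" for j A
    using arg_min_natI[of "\<lambda>A. A \<in> B \<and> j \<in> A" A e] arg_min_nat_le[of "\<lambda>A. A \<in> B \<and> j \<in> A" A e] that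
    by (auto simp: m_def)
  define r where "r j = (if j \<in> \<Union>B then m j else {})" for j
  show "j \<in> r j" if "r j \<in> B" for j
    using m(2) that assms(2) by (cases "j \<in> \<Union>B") (auto simp: r_def)
  show "finite {j\<in>A. r j \<noteq> A}" if A: "A \<in> B" for A
  proof -
    \<comment> \<open>Only finitely many members of \<open>B\<close> are numbered before
      \<open>A\<close>, and each meets \<open>A\<close> in a finite set. If \<open>j \<in> A\<close>
      is not assigned to \<open>A\<close>, it lies in one of them.\<close>
    have "finite (e -` {..e A} \<inter> B)" by (rule finite_vimage_IntI[OF _ e]) simp
    then have "finite (\<Union>A'\<in>(e -` {..e A} \<inter> B) - {A}. A \<inter> A')"
      using ad A by (intro finite_UN_I) (auto simp: pairwise_def)
    moreover have "{j\<in>A. r j \<noteq> A} \<subseteq> (\<Union>A'\<in>(e -` {..e A} \<inter> B) - {A}. A \<inter> A')"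
    proof
      fix j assume j: "j \<in> {j\<in>A. r j \<noteq> A}"
      then have "r j = m j" using A by (auto simp: r_def)
      then show "j \<in> (\<Union>A'\<in>(e -` {..e A} \<inter> B) - {A}. A \<inter> A')"
        using m[OF A, of j] j by auto
    qed
    ultimately show ?thesis by (rule rev_finite_subset)
  qed
qed

text \<open>Subtracting at \<open>Xpt j\<close> the limit along the set \<open>r j\<close> turns
  convergence at the points \<open>Ypt A\<close> into convergence to zero. For
  \<open>r j \<notin> B\<close> the functions concerned vanish at \<open>Ypt (r j)\<close>, so the
  junk values of \<open>r\<close> do no harm.\<close>

definition flatten :: "(nat \<Rightarrow> nat set) \<Rightarrow> (psi_point \<Rightarrow> 'k::ring) \<Rightarrow> psi_point \<Rightarrow> 'k" where
  "flatten r f p = f p - (case p of Xpt j \<Rightarrow> f (Ypt (r j)) | Ypt A \<Rightarrow> 0)"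

definition unflatten :: "(nat \<Rightarrow> nat set) \<Rightarrow> (psi_point \<Rightarrow> 'k::ring) \<Rightarrow> psi_point \<Rightarrow> 'k" where
  "unflatten r g p = g p + (case p of Xpt j \<Rightarrow> g (Ypt (r j)) | Ypt A \<Rightarrow> 0)"

text \<open>Both maps keep the values at all \<open>Ypt A\<close>, so what one subtracts the other
  adds back.\<close>

lemma unflatten_flatten: "unflatten r (flatten r f) = f"
  by (auto simp: unflatten_def flatten_def fun_eq_iff split: psi_point.splits)

lemma flatten_add: "flatten r (f + g) = flatten r f + flatten r g"
  by (auto simp: flatten_def fun_eq_iff split: psi_point.splits)

lemma flatten_scale: "flatten r (\<lambda>p. c * f p) = (\<lambda>p. c * flatten r f p)"
  by (auto simp: flatten_def fun_eq_iff algebra_simps split: psi_point.splits)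

lemma flatten_zero: "flatten r 0 = 0"
  by (auto simp: flatten_def fun_eq_iff split: psi_point.splits)

lemma norm_flatten_le:
  fixes f :: "psi_point \<Rightarrow> 'k::real_normed_field"
  assumes "\<And>p. norm (f p) \<le> M"
  shows "norm (flatten r f p) \<le> 2 * M"
proof (cases p)
  case (Xpt j)
  then show ?thesis
    using norm_triangle_ineq4[of "f p" "f (Ypt (r j))"] assms[of p] assms[of "Ypt (r j)"]
    by (simp add: flatten_def)
next
  case (Ypt A)
  then show ?thesis
    using assms[of p] norm_ge_zero[of "f p"] by (simp add: flatten_def del: norm_ge_zero)
qed

lemma norm_unflatten_le:
  fixes f :: "psi_point \<Rightarrow> 'k::real_normed_field"
  assumes "\<And>p. norm (f p) \<le> M"
  shows "norm (unflatten r f p) \<le> 2 * M"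
proof (cases p)
  case (Xpt j)
  then show ?thesis
    using norm_triangle_ineq[of "f p" "f (Ypt (r j))"] assms[of p] assms[of "Ypt (r j)"]
    by (simp add: unflatten_def)
next
  case (Ypt A)
  then show ?thesis
    using assms[of p] norm_ge_zero[of "f p"] by (simp add: unflatten_def del: norm_ge_zero)
qed

text \<open>Suppose that the flattened value at \<open>Xpt j\<close> is large. Either
  \<open>f\<close> is large at \<open>Ypt (r j)\<close>, which happens for finitely many sets, and
  \<open>f\<close> converges along each. Or \<open>f\<close> is large at \<open>Xpt j\<close>; then,
  up to finitely many \<open>j\<close>, some \<open>A\<close> from a finite collection contains
  \<open>j\<close>, and either \<open>f (Xpt j)\<close> is far from its limit along \<open>A\<close>
  or \<open>j\<close> is not assigned to \<open>A\<close>.\<close>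

lemma flatten_c0_on:
  fixes f :: "psi_point \<Rightarrow> 'k::real_normed_field"
  assumes f: "f \<in> C0 (psi_space \<A>)" and B: "\<And>A. A \<notin> B \<Longrightarrow> f (Ypt A) = 0"
    and r: "\<And>j. r j \<in> B \<Longrightarrow> j \<in> r j" "\<And>A. A \<in> B \<Longrightarrow> finite {j\<in>A. r j \<noteq> A}"
  shows "flatten r f \<in> c0_on (range Xpt \<union> Ypt ` B)"
  unfolding c0_on_def
proof (intro CollectI conjI allI impI)
  fix p assume "p \<notin> range Xpt \<union> Ypt ` B"
  then show "flatten r f p = 0"
    using B by (cases p) (auto simp: flatten_def)
next
  fix e :: real assume e: "e > 0"
  define H where "H = {A. e/4 \<le> norm (f (Ypt A))}"
  have e4: "e/4 > 0" "e/2 > 0" using e by auto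
  have H: "finite H" unfolding H_def by (rule C0_psi_space_finite_Ypt[OF f e4(1)])
  have HB: "A \<in> B" if "A \<in> H" for A
    using B[of A] that e by (force simp: H_def)
  have H\<A>: "A \<in> \<A>" if "A \<in> H" for A
  proof -
    have "f (Ypt A) \<noteq> 0" using that e by (auto simp: H_def)
    then show ?thesis using C0_psi_space_Ypt_outside[OF f] by blast
  qed
  obtain F \<G> where FG: "finite F" "finite \<G>" "\<G> \<subseteq> \<A>" and
    sub: "{p \<in> topspace (psi_space \<A>). e/2 \<le> norm (f p)} \<subseteq> Xpt ` F \<union> (\<Union>A\<in>\<G>. psi_nhd A {})"
    using f e4(2) unfolding C0_psi_space_iff by meson
  define J where "J = (\<Union>A\<in>H \<union> \<G>. {j\<in>A. e/4 \<le> norm (f (Xpt j) - f (Ypt A))}) \<union> F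
    \<union> (\<Union>A\<in>H. {j\<in>A. r j \<noteq> A})"
  have cont: "finite {j\<in>A. e/4 \<le> norm (f (Xpt j) - f (Ypt A))}" if "A \<in> \<A>" for A
    using f e4(1) that unfolding C0_psi_space_iff by blast
  have "finite J"
    unfolding J_def using FG H HB H\<A> cont r(2) by auto
  have "j \<in> J" if j: "e \<le> norm (f (Xpt j) - f (Ypt (r j)))" for j
  proof (cases "r j \<in> H")
    case True
    moreover have "e/4 \<le> norm (f (Xpt j) - f (Ypt (r j)))" using j e by linarith
    ultimately show ?thesis
      using r(1)[OF HB[OF True]] unfolding J_def by (intro UnI1 UN_I[of "r j"]) simp_all
  next
    case False
    \<comment> \<open>Less than \<open>e/4\<close> is lost to \<open>f (Ypt (r j))\<close>. What
      remains exceeds the level \<open>e/2\<close> of the cover and is still \<open>e/4\<close> away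
      from \<open>f (Ypt A)\<close> whenever \<open>A \<notin> H\<close>.\<close>
    then have "norm (f (Xpt j)) \<ge> 3/4 * e"
      using j norm_triangle_ineq4[of "f (Xpt j)" "f (Ypt (r j))"] by (auto simp: H_def)
    then have "Xpt j \<in> {p \<in> topspace (psi_space \<A>). e/2 \<le> norm (f p)}" using e by auto
    then have "Xpt j \<in> Xpt ` F \<union> (\<Union>A\<in>\<G>. psi_nhd A {})" using sub by (rule rev_subsetD)
    then have "j \<in> F \<or> (\<exists>A\<in>\<G>. j \<in> A)" by auto
    then consider "j \<in> F" | A where "A \<in> \<G>" "j \<in> A" by blast
    then show ?thesis
    proof cases
      case 1
      then show ?thesis by (simp add: J_def)
    next
      case (2 A)
      show ?thesis
      proof (cases "A \<in> H")
        case True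
        moreover have "r j \<noteq> A" using False True by blast
        ultimately show ?thesis
          using 2 unfolding J_def by (intro UnI2 UN_I[of A]) simp_all
      next
        case False
        then have "e/4 \<le> norm (f (Xpt j) - f (Ypt A))"
          using \<open>norm (f (Xpt j)) \<ge> 3/4 * e\<close> e norm_triangle_ineq2[of "f (Xpt j)" "f (Ypt A)"]
          by (auto simp: H_def)
        then show ?thesis
          using 2 unfolding J_def by (intro UnI1[OF UnI1] UN_I[of A]) simp_all
      qed
    qed
  qed
  moreover have "p \<in> Xpt ` J \<union> Ypt ` H" if "e \<le> norm (flatten r f p)" for p
    using that e calculation by (cases p) (auto simp: flatten_def H_def)
  ultimately have "{p. e \<le> norm (flatten r f p)} \<subseteq> Xpt ` J \<union> Ypt ` H"
    by blast
  then show "finite {p. e \<le> norm (flatten r f p)}"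
    using \<open>finite J\<close> H by (meson finite_UnI finite_imageI finite_subset)
qed

text \<open>At \<open>A \<in> B\<close> continuity holds because \<open>r j = A\<close> for almost
  all \<open>j \<in> A\<close>. At \<open>A \<notin> B\<close>, almost disjointness from the
  finitely many members of \<open>B\<close> where \<open>g\<close> is large keeps the added values
  small along \<open>A\<close>.\<close>

lemma unflatten_C0:
  fixes g :: "psi_point \<Rightarrow> 'k::real_normed_field"
  assumes ad: "pairwise (\<lambda>A A'. finite (A \<inter> A')) \<A>"
    and g: "g \<in> c0_on (range Xpt \<union> Ypt ` B)" and B: "B \<subseteq> \<A>"
    and r: "\<And>j. r j \<in> B \<Longrightarrow> j \<in> r j" "\<And>A. A \<in> B \<Longrightarrow> finite {j\<in>A. r j \<noteq> A}"
  shows "unflatten r g \<in> C0 (psi_space \<A>)"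
proof -
  have Y: "g (Ypt A) = 0" if "A \<notin> B" for A
    using g that by (auto simp: c0_on_def)
  have fin: "finite {j. e \<le> norm (g (Xpt j))}" "finite {A. e \<le> norm (g (Ypt A))}" if "e > 0" for e
  proof -
    have "finite {p. e \<le> norm (g p)}" using g that by (simp add: c0_on_def)
    then have "finite (Xpt -` {p. e \<le> norm (g p)})" "finite (Ypt -` {p. e \<le> norm (g p)})"
      by (auto intro!: finite_vimageI simp: inj_on_def simp del: vimage_Collect_eq)
    then show "finite {j. e \<le> norm (g (Xpt j))}" "finite {A. e \<le> norm (g (Ypt A))}"
      by (simp_all add: vimage_def)
  qed
  have cases: "e/2 \<le> norm (g (Xpt j)) \<or> (e/2 \<le> norm (g (Ypt (r j))) \<and> r j \<in> B \<and> j \<in> r j)"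
    if "e \<le> norm (g (Xpt j) + g (Ypt (r j)))" "e > 0" for e j
  proof (cases "e/2 \<le> norm (g (Xpt j))")
    case False
    then have *: "e/2 \<le> norm (g (Ypt (r j)))"
      using that(1) norm_triangle_ineq[of "g (Xpt j)" "g (Ypt (r j))"] by linarith
    then have "g (Ypt (r j)) \<noteq> 0" using that(2) by auto
    then show ?thesis using * Y r(1) by blast
  qed simp
  show ?thesis
    unfolding C0_psi_space_iff
  proof (intro conjI ballI allI impI)
    fix A and e :: real assume A: "A \<in> \<A>" and e: "e > 0"
    let ?X = "{j. e/2 \<le> norm (g (Xpt j))}" and ?Y = "{A. e/2 \<le> norm (g (Ypt A))} \<inter> B"
    have fX: "finite ?X" and fY: "finite ?Y" using fin[of "e/2"] e by auto
    show "finite {j \<in> A. e \<le> norm (unflatten r g (Xpt j) - unflatten r g (Ypt A))}" (is "finite ?S")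
    proof (cases "A \<in> B")
      case True
      \<comment> \<open>Where \<open>r j = A\<close> the added value cancels against
        \<open>g (Ypt A)\<close> and only \<open>g (Xpt j)\<close> is left.\<close>
      have "?S \<subseteq> {j\<in>A. r j \<noteq> A} \<union> ?X"
        using e by (auto simp: unflatten_def)
      then show ?thesis using r(2)[OF True] fX by (meson finite_UnI finite_subset)
    next
      case False
      have "?S \<subseteq> ?X \<union> (\<Union>A'\<in>?Y. A \<inter> A')"
      proof
        fix j assume "j \<in> ?S"
        then show "j \<in> ?X \<union> (\<Union>A'\<in>?Y. A \<inter> A')"
          using cases[of e j] e Y[OF False] by (auto simp: unflatten_def)
      qed
      moreover have "finite (\<Union>A'\<in>?Y. A \<inter> A')"
      proof (rule finite_UN_I[OF fY])
        fix A' assume "A' \<in> ?Y"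
        then have "A' \<in> \<A>" "A \<noteq> A'" using B False by auto
        then show "finite (A \<inter> A')" using ad A by (simp add: pairwise_def)
      qed
      ultimately show ?thesis using fX by (meson finite_UnI finite_subset)
    qed
  next
    fix e :: real assume e: "e > 0"
    let ?X = "{j. e/2 \<le> norm (g (Xpt j))}" and ?Y = "{A. e/2 \<le> norm (g (Ypt A))} \<inter> B"
    have fX: "finite ?X" and fY: "finite ?Y" using fin[of "e/2"] e by auto
    have "p \<in> Xpt ` ?X \<union> (\<Union>A\<in>?Y. psi_nhd A {})" if p: "e \<le> norm (unflatten r g p)" for p
    proof (cases p)
      case (Xpt j)
      then show ?thesis using p cases[of e j] e by (auto simp: unflatten_def)
    next
      case (Ypt A)
      then show ?thesis using p e Y[of A] by (cases "A \<in> B") (auto simp: unflatten_def)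
    qed
    then show "\<exists>F \<G>. finite F \<and> finite \<G> \<and> \<G> \<subseteq> \<A> \<and>
        {p \<in> topspace (psi_space \<A>). e \<le> norm (unflatten r g p)}
          \<subseteq> Xpt ` F \<union> (\<Union>A\<in>\<G>. psi_nhd A {})"
      using fX fY B by (intro exI[of _ ?X] exI[of _ ?Y]) auto
  next
    fix p assume "p \<notin> topspace (psi_space \<A>)"
    then show "unflatten r g p = 0"
      using B Y by (cases p) (auto simp: unflatten_def)
  qed
qed

section \<open>Operators whose range lives on a countable subfamily\<close>

text \<open>The differences in the conclusion are the coordinates of a projection onto c_0(D). Any
  member of the family serves as both \<open>D\<close> and \<open>A0\<close>. For the empty family
  the space is discrete, all its functions are null sequences, and \<open>{}\<close> is a junk index
  with value \<open>0\<close>.\<close>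

lemma C0_psi_space_c0_complemented:
  assumes "\<forall>A\<in>\<A>. infinite A"
  obtains D A0 where "infinite D"
    "\<And>(f :: psi_point \<Rightarrow> 'k::real_normed_field) e. f \<in> C0 (psi_space \<A>) \<Longrightarrow> e > 0 \<Longrightarrow>
      finite {n\<in>D. e \<le> norm (f (Xpt n) - f (Ypt A0))}"
proof (cases "\<A> = {}")
  case True
  show ?thesis
  proof (rule that[of UNIV "{}"])
    fix f :: "psi_point \<Rightarrow> 'k" and e :: real
    assume f: "f \<in> C0 (psi_space \<A>)" and e: "e > 0"
    obtain F \<G> where F: "finite F" and \<G>: "\<G> \<subseteq> \<A>"
      and sub: "{p \<in> topspace (psi_space \<A>). e \<le> norm (f p)} \<subseteq> Xpt ` F \<union> (\<Union>A\<in>\<G>. psi_nhd A {})"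
      using f e unfolding C0_psi_space_iff by meson
    have "\<G> = {}" using \<G> True by simp
    have "{n\<in>UNIV. e \<le> norm (f (Xpt n) - f (Ypt {}))} \<subseteq> F"
    proof
      fix n assume n: "n \<in> {n\<in>UNIV. e \<le> norm (f (Xpt n) - f (Ypt {}))}"
      have "f (Ypt {}) = 0" using C0_psi_space_Ypt_outside[OF f, of "{}"] True by simp
      then have "Xpt n \<in> {p \<in> topspace (psi_space \<A>). e \<le> norm (f p)}" using n by simp
      then have "Xpt n \<in> Xpt ` F \<union> (\<Union>A\<in>\<G>. psi_nhd A {})" using sub by (rule rev_subsetD)
      then show "n \<in> F" using \<open>\<G> = {}\<close> by auto
    qed
    then show "finite {n\<in>UNIV. e \<le> norm (f (Xpt n) - f (Ypt {}))}"
      using F finite_subset by blast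
  qed simp
next
  case False
  then obtain A0 where "A0 \<in> \<A>" by blast
  with assms show ?thesis
    by (intro that[of A0 A0]) (auto simp: C0_psi_space_iff)
qed

text \<open>Writing \<open>E\<^sub>B\<close> for the functions that vanish at \<open>y\<^sub>A\<close> for \<open>A \<notin> B\<close>: since \<open>E\<^sub>B\<close> is a copy of
  \<open>c\<^sub>0\<close> and \<open>c\<^sub>0 \<cong> c\<^sub>0(\<nat> \<times> \<nat>)\<close> is complemented in the whole space, operators \<open>T n\<close> into \<open>E\<^sub>B\<close> with norms
  tending to \<open>0\<close> are the rows of one operator \<open>S\<close>. The row maps \<open>Q n\<close> do not depend on the \<open>T n\<close>.\<close>

lemma row_operators:
  fixes \<A> :: "nat set set"
  assumes inf: "\<forall>A\<in>\<A>. infinite A"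
    and ad: "pairwise (\<lambda>A A'. finite (A \<inter> A')) \<A>"
    and B: "countable B" "B \<subseteq> \<A>"
  defines "K \<equiv> psi_space \<A>"
  obtains Q :: "nat \<Rightarrow> (psi_point, 'k::real_normed_field) operator"
  where "\<And>n. Q n \<in> bounded_ops K"
    and "\<And>T. (\<And>n. T n \<in> bounded_ops K) \<Longrightarrow> (\<lambda>n. op_norm K (T n)) \<longlonglongrightarrow> 0 \<Longrightarrow>
      (\<And>n f A. f \<in> C0 K \<Longrightarrow> A \<notin> B \<Longrightarrow> T n f (Ypt A) = 0) \<Longrightarrow>
      \<exists>S\<in>bounded_ops K. \<forall>n. Q n \<circ> S = T n"
proof -
  have K: "topspace K \<noteq> {}" by (simp add: K_def)
  have "{} \<notin> B" using B(2) inf by auto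
  then obtain r where r: "\<And>j. r j \<in> B \<Longrightarrow> j \<in> r j"
      "\<And>A. A \<in> B \<Longrightarrow> finite {j\<in>A. r j \<noteq> A}"
    using countable_disjointification[OF B(1) _ pairwise_subset[OF ad B(2)]] by metis
  obtain D A0 where D: "infinite (D :: nat set)"
    "\<And>(f :: psi_point \<Rightarrow> 'k) e. f \<in> C0 K \<Longrightarrow> e > 0 \<Longrightarrow>
      finite {n\<in>D. e \<le> norm (f (Xpt n) - f (Ypt A0))}"
    unfolding K_def by (rule C0_psi_space_c0_complemented[OF inf]) blast
  define S where "S = range Xpt \<union> Ypt ` B"
  define Z where "Z = (UNIV :: nat set) \<times> S"
  have "countable Z" unfolding Z_def S_def using B(1) by auto
  \<comment> \<open>Numbering \<open>Z\<close> and then enumerating \<open>D\<close> gives every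
    pair of a row and a point of \<open>S\<close> its own isolated point, which places a copy of
    c_0(Z) inside c_0(D).\<close>
  define \<iota> where "\<iota> z = enumerate D (to_nat_on Z z)" for z
  have \<iota>: "inj_on \<iota> Z"
    using inj_on_to_nat_on[OF \<open>countable Z\<close>] strict_mono_enumerate[OF D(1)]
    by (auto simp: \<iota>_def inj_on_def strict_mono_eq)
  have \<iota>D: "\<iota> z \<in> D" for z unfolding \<iota>_def by (rule enumerate_in_set[OF D(1)])

  \<comment> \<open>Subtracting \<open>g (Ypt A0)\<close> makes the row a null family.\<close>
  define row where "row n g p = (if p \<in> S then g (Xpt (\<iota> (n, p))) - g (Ypt A0) else 0)"
    for n and g :: "psi_point \<Rightarrow> 'k" and p
  have row_le: "norm (row n g p) \<le> 2 * sup_norm K g" if "g \<in> C0 K" for n g p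
    using norm_triangle_ineq4[of "g (Xpt (\<iota> (n, p)))" "g (Ypt A0)"] sup_norm_nonneg[OF K that]
      norm_le_sup_norm_everywhere[OF K that, of "Xpt (\<iota> (n, p))"]
      norm_le_sup_norm_everywhere[OF K that, of "Ypt A0"]
    by (auto simp: row_def)
  have row_c0: "row n g \<in> c0_on S" if g: "g \<in> C0 K" for n g
    unfolding c0_on_def
  proof (intro CollectI conjI allI impI)
    fix e :: real assume e: "e > 0"
    have "(\<lambda>p. \<iota> (n, p)) ` {p. e \<le> norm (row n g p)} \<subseteq> {n\<in>D. e \<le> norm (g (Xpt n) - g (Ypt A0))}"
      using e \<iota>D by (auto simp: row_def split: if_splits)
    then have "finite ((\<lambda>p. \<iota> (n, p)) ` {p. e \<le> norm (row n g p)})"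
      using D(2)[OF g e] finite_subset by blast
    moreover have "inj_on (\<lambda>p. \<iota> (n, p)) {p. e \<le> norm (row n g p)}"
    proof (rule inj_onI)
      fix p q assume "p \<in> {p. e \<le> norm (row n g p)}" "q \<in> {p. e \<le> norm (row n g p)}"
        and eq: "\<iota> (n, p) = \<iota> (n, q)"
      then have "p \<in> S" "q \<in> S" using e by (auto simp: row_def split: if_splits)
      then show "p = q" using inj_onD[OF \<iota> eq] by (simp add: Z_def)
    qed
    ultimately show "finite {p. e \<le> norm (row n g p)}" by (rule finite_imageD)
  qed (simp add: row_def)

  define Q where "Q n g = (if g \<in> C0 K then unflatten r (row n g) else 0)"
    for n and g :: "psi_point \<Rightarrow> 'k"
  \<comment> \<open>The constant \<open>4\<close> arises because forming a row and unflattening it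
    each at most double the norm.\<close>
  have Q: "Q n \<in> bounded_ops K" for n
    unfolding bounded_ops_def
  proof (intro CollectI conjI ballI allI impI exI[of _ 4])
    fix f g :: "psi_point \<Rightarrow> 'k" and c assume f: "f \<in> C0 K"
    show "Q n f \<in> C0 K"
      using unflatten_C0[OF ad row_c0[OF f, unfolded S_def] B(2) r] f
      by (simp add: Q_def K_def)
    show "sup_norm K (Q n f) \<le> 4 * sup_norm K f"
      using norm_unflatten_le[of "row n f" "2 * sup_norm K f" r] row_le[OF f] f
      by (intro sup_norm_le[OF K]) (simp add: Q_def)
    show "Q n (\<lambda>p. c * f p) = (\<lambda>p. c * Q n f p)"
      using f C0_scale[OF f, of c]
      by (auto simp: Q_def unflatten_def row_def fun_eq_iff algebra_simps split: psi_point.splits)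
    show "Q n (f + g) = Q n f + Q n g" if "g \<in> C0 K"
      using f that C0_add[OF f that]
      by (auto simp: Q_def unflatten_def row_def fun_eq_iff algebra_simps split: psi_point.splits)
  qed (simp add: Q_def)

  show ?thesis
  proof (rule that[OF Q])
    fix T :: "nat \<Rightarrow> (psi_point, 'k) operator"
    assume T: "\<And>n. T n \<in> bounded_ops K" and T0: "(\<lambda>n. op_norm K (T n)) \<longlonglongrightarrow> 0"
      and TB: "\<And>n f A. f \<in> C0 K \<Longrightarrow> A \<notin> B \<Longrightarrow> T n f (Ypt A) = 0"
    define \<delta> where "\<delta> f z = flatten r (T (fst z) f) (snd z)" for f z
    \<comment> \<open>The common right factor: it writes the flattened values of all
      \<open>T n f\<close> at the points reserved for them in \<open>D\<close>, and zero everywhere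
      else.\<close>
    define U where "U f p = (case p of Ypt A \<Rightarrow> 0
        | Xpt d \<Rightarrow> if d \<in> \<iota> ` Z then \<delta> f (inv_into Z \<iota> d) else 0)" for f p
    have U\<iota>: "U f (Xpt (\<iota> z)) = \<delta> f z" if "z \<in> Z" for f z
      using that \<iota> by (simp add: U_def)
    have flat_c0: "flatten r (T n f) \<in> c0_on S" if f: "f \<in> C0 K" for n f
      using bounded_ops_C0[OF T f, of n] TB[OF f] r
      unfolding S_def K_def by (intro flatten_c0_on) auto
    have \<delta>_le: "norm (\<delta> f z) \<le> 2 * (op_norm K (T (fst z)) * sup_norm K f)" if f: "f \<in> C0 K" for f z
    proof -
      have "norm (T (fst z) f p) \<le> op_norm K (T (fst z)) * sup_norm K f" for p
        using norm_le_sup_norm_everywhere[OF K bounded_ops_C0[OF T f], of "fst z" p]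
          sup_norm_le_op_norm_mult[OF K T f, of "fst z"] by linarith
      then show ?thesis
        using norm_flatten_le[of "T (fst z) f" "op_norm K (T (fst z)) * sup_norm K f" r "snd z"]
        by (simp add: \<delta>_def)
    qed
    have U_c0: "U f \<in> c0_on (range Xpt)" if f: "f \<in> C0 K" for f
      unfolding c0_on_def
    proof (intro CollectI conjI allI impI)
      fix p assume "p \<notin> range Xpt"
      then show "U f p = 0" by (cases p) (auto simp: U_def)
    next
      fix e :: real assume e: "e > 0"
      have "(\<lambda>n. 2 * (op_norm K (T n) * sup_norm K f)) \<longlonglongrightarrow> 2 * (0 * sup_norm K f)"
        by (intro tendsto_intros T0)
      then have "\<forall>\<^sub>F n in sequentially. 2 * (op_norm K (T n) * sup_norm K f) < e"
        using e by (intro order_tendstoD) auto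
      then obtain N where N: "\<And>n. n \<ge> N \<Longrightarrow> 2 * (op_norm K (T n) * sup_norm K f) < e"
        by (auto simp: eventually_sequentially)
      \<comment> \<open>The operator norms tend to \<open>0\<close>, so only the rows
        \<open>n < N\<close> can reach \<open>e\<close>, each at finitely many points.\<close>
      let ?P = "\<Union>n<N. Pair n ` {q. e \<le> norm (flatten r (T n f) q)}"
      have fin: "finite ?P"
        using flat_c0[OF f] e by (auto simp: c0_on_def)
      have "p \<in> (\<lambda>z. Xpt (\<iota> z)) ` ?P" if p: "e \<le> norm (U f p)" for p
      proof -
        obtain z where z: "z \<in> Z" "p = Xpt (\<iota> z)"
          using p e by (auto simp: U_def split: psi_point.splits if_splits)
        then have e\<delta>: "e \<le> norm (\<delta> f z)" using p U\<iota> by simp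
        then have "fst z < N"
          using N[of "fst z"] \<delta>_le[OF f, of z] by (meson leD le_less_trans not_le_imp_less order_trans)
        then have "z \<in> ?P" using e\<delta> by (cases z) (auto simp: \<delta>_def)
        then show ?thesis using z(2) by blast
      qed
      then have "{p. e \<le> norm (U f p)} \<subseteq> (\<lambda>z. Xpt (\<iota> z)) ` ?P" by auto
      then show "finite {p. e \<le> norm (U f p)}"
        by (rule finite_subset[OF _ finite_imageI[OF fin]])
    qed
    have U_C0: "U f \<in> C0 K" if "f \<in> C0 K" for f
      unfolding K_def by (rule c0_on_Xpt_subset_C0[OF U_c0[OF that]])
    obtain M where M: "\<And>n. op_norm K (T n) \<le> M"
      using convergent_imp_Bseq[OF convergentI[OF T0]] unfolding Bseq_def
      by (metis abs_le_D1 real_norm_def)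
    have "U \<in> bounded_ops K"
      unfolding bounded_ops_def
    proof (intro CollectI conjI ballI allI impI exI[of _ "2 * M"])
      fix f g :: "psi_point \<Rightarrow> 'k" and c assume f: "f \<in> C0 K"
      show "U f \<in> C0 K" by (rule U_C0[OF f])
      have "0 \<le> M" using M[of 0] op_norm_nonneg[OF K T] order_trans by blast
      have "norm (U f p) \<le> 2 * M * sup_norm K f" for p
      proof (cases "U f p = 0")
        case True
        then show ?thesis using \<open>0 \<le> M\<close> sup_norm_nonneg[OF K f] by simp
      next
        case False
        then obtain z where "z \<in> Z" "p = Xpt (\<iota> z)"
          by (auto simp: U_def split: psi_point.splits if_splits)
        then show ?thesis
          using U\<iota> \<delta>_le[OF f, of z] mult_right_mono[OF M sup_norm_nonneg[OF K f], of "fst z"] by simp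
      qed
      then show "sup_norm K (U f) \<le> 2 * M * sup_norm K f" by (intro sup_norm_le[OF K])
      have "T n (\<lambda>p. c * f p) = (\<lambda>p. c * T n f p)" for n
        using T f by (simp add: bounded_ops_def)
      then have "\<delta> (\<lambda>p. c * f p) z = c * \<delta> f z" for z
        by (simp add: \<delta>_def flatten_scale)
      then show "U (\<lambda>p. c * f p) = (\<lambda>p. c * U f p)"
        by (simp add: U_def fun_eq_iff split: psi_point.splits)
      show "U (f + g) = U f + U g" if g: "g \<in> C0 K"
      proof -
        have "T n (f + g) = T n f + T n g" for n
          using T f g by (simp add: bounded_ops_def)
        then have "\<delta> (f + g) z = \<delta> f z + \<delta> g z" for z
          by (simp add: \<delta>_def flatten_add)
        then show ?thesis
          by (simp add: U_def fun_eq_iff split: psi_point.splits)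
      qed
    next
      fix f :: "psi_point \<Rightarrow> 'k" assume "f \<notin> C0 K"
      then have "T n f = 0" for n using T by (simp add: bounded_ops_def)
      then have "\<delta> f z = 0" for z
        by (simp add: \<delta>_def flatten_zero)
      then show "U f = 0"
        by (simp add: U_def fun_eq_iff split: psi_point.splits)
    qed
    moreover have "Q n \<circ> U = T n" for n
    proof
      fix f
      show "(Q n \<circ> U) f = T n f"
      proof (cases "f \<in> C0 K")
        case True
        \<comment> \<open>The row map reads back what \<open>U\<close> has written, since
          \<open>\<iota>\<close> is injective on \<open>Z\<close> and \<open>U f\<close> vanishes at
          \<open>Ypt A0\<close>.\<close>
        have "row n (U f) p = flatten r (T n f) p" for p
        proof (cases "p \<in> S")
          case True
          then show ?thesis
            using U\<iota>[of "(n, p)" f] by (simp add: row_def Z_def \<delta>_def) (simp add: U_def)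
        next
          case False
          then show ?thesis using flat_c0[OF \<open>f \<in> C0 K\<close>] by (simp add: row_def c0_on_def)
        qed
        then have "row n (U f) = flatten r (T n f)" by blast
        then show ?thesis using U_C0[OF True] by (simp add: Q_def unflatten_flatten)
      next
        case False
        \<comment> \<open>Operators are total functions, so the factorisation is also checked off
          \<open>C0 K\<close>, where both sides are \<open>0\<close>.\<close>
        then have "U f = 0" "T n f = 0"
          using \<open>U \<in> bounded_ops K\<close> T by (auto simp: bounded_ops_def)
        then show ?thesis using bounded_ops_zero[OF Q] by simp
      qed
    qed
    ultimately show "\<exists>S\<in>bounded_ops K. \<forall>n. Q n \<circ> S = T n" by blast
  qed
qed

section \<open>A closed subspace that contains the operators with separable range\<close>

definition countable_range_ops ::
  "nat set set \<Rightarrow> (psi_point, 'k::real_normed_field) operator set" where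
  "countable_range_ops \<A> = {T \<in> bounded_ops (psi_space \<A>).
     \<exists>B. countable B \<and> (\<forall>f\<in>C0 (psi_space \<A>). \<forall>A. A \<notin> B \<longrightarrow> T f (Ypt A) = 0)}"

text \<open>Each member of a countable dense subset of the range is nonzero at countably many points
  \<open>Ypt A\<close> only, and a uniform limit of functions vanishing at a point vanishes
  there.\<close>

lemma separable_range_subset_countable_range:
  "separable_range_ops (psi_space \<A>) \<subseteq>
     (countable_range_ops \<A> :: (psi_point, 'k::real_normed_field) operator set)"
proof
  let ?K = "psi_space \<A>"
  fix T :: "(psi_point, 'k) operator" assume "T \<in> separable_range_ops ?K"
  then have T: "T \<in> bounded_ops ?K"
    and "separable_space (subtopology (C0_topology ?K) (T ` C0 ?K))"
    by (auto simp: separable_range_ops_def)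
  interpret Metric_space "C0 ?K :: (psi_point \<Rightarrow> 'k) set" "C0_dist ?K"
    by (rule Metric_space_C0) simp
  have sub: "T ` C0 ?K \<subseteq> C0 ?K" using bounded_ops_C0[OF T] by blast
  have top: "topspace (subtopology (C0_topology ?K) (T ` C0 ?K)) = T ` C0 ?K"
    using sub by (auto simp: C0_topology_def)
  obtain C where C: "countable C" "C \<subseteq> T ` C0 ?K"
    "subtopology (C0_topology ?K) (T ` C0 ?K) closure_of C = T ` C0 ?K"
    using \<open>separable_space _\<close> unfolding separable_space_def top by blast
  define B where "B = (\<Union>g\<in>C. {A. g (Ypt A) \<noteq> 0})"
  have "countable B"
    unfolding B_def using C(1,2) sub
    by (intro countable_UN C0_psi_space_countable_Ypt[of _ \<A>]) auto
  moreover have "T f (Ypt A) = 0" if f: "f \<in> C0 ?K" and A: "A \<notin> B" for f A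
  proof (cases "A \<in> \<A>")
    case False
    then show ?thesis using C0_psi_space_Ypt_outside[OF bounded_ops_C0[OF T f]] by blast
  next
    case True
    have Tf: "T f \<in> C0 ?K" by (rule bounded_ops_C0[OF T f])
    have "T f \<in> C0_topology ?K closure_of C"
      using C(3) f by (simp add: closure_of_subtopology Int_absorb1[OF C(2)]) blast
    then have close: "\<exists>g\<in>C. g \<in> mball (T f) e" if "e > 0" for e
      using that Tf unfolding in_closure_of C0_topology_def
      by (meson centre_in_mball_iff openin_mball)
    have "norm (T f (Ypt A)) < e" if e: "e > 0" for e
    proof -
      obtain g where g: "g \<in> C" "g \<in> mball (T f) e" using close[OF e] by blast
      then have gC0: "g \<in> C0 ?K" and "sup_norm ?K (T f - g) < e"
        using Tf by (auto simp: C0_dist_def)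
      then have "norm ((T f - g) (Ypt A)) < e"
        using norm_le_sup_norm[OF C0_diff[OF Tf gC0], of "Ypt A"] True by simp
      moreover have "g (Ypt A) = 0" using A g(1) by (auto simp: B_def)
      ultimately show ?thesis by simp
    qed
    then have "\<not> 0 < norm (T f (Ypt A))" by blast
    then show ?thesis by simp
  qed
  ultimately show "T \<in> countable_range_ops \<A>"
    using T unfolding countable_range_ops_def by blast
qed

lemma countable_range_ops_subspace:
  "module.subspace op_scale (countable_range_ops \<A> :: (psi_point, 'k::real_normed_field) operator set)"
proof -
  interpret vector_space "op_scale :: 'k \<Rightarrow> (psi_point, 'k) operator \<Rightarrow> _"
    by (rule vector_space_op_scale)
  show ?thesis
  proof (rule subspaceI)
    show "0 \<in> countable_range_ops \<A>"
      by (auto simp: countable_range_ops_def bounded_ops_zero_op intro: exI[of _ "{}"])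
    show "op_scale c T \<in> countable_range_ops \<A>" if "T \<in> countable_range_ops \<A>"
      for c and T :: "(psi_point, 'k) operator"
    proof -
      have "op_scale c T \<in> bounded_ops (psi_space \<A>)"
        using that by (simp add: countable_range_ops_def bounded_ops_scale)
      then show ?thesis using that by (auto simp: countable_range_ops_def op_scale_def)
    qed
    fix S T :: "(psi_point, 'k) operator"
    assume S: "S \<in> countable_range_ops \<A>" and T: "T \<in> countable_range_ops \<A>"
    obtain B C where B: "countable B" "\<forall>f\<in>C0 (psi_space \<A>). \<forall>A. A \<notin> B \<longrightarrow> S f (Ypt A) = 0"
      and C: "countable C" "\<forall>f\<in>C0 (psi_space \<A>). \<forall>A. A \<notin> C \<longrightarrow> T f (Ypt A) = 0"
      using S T unfolding countable_range_ops_def by blast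
    then have "countable (B \<union> C)"
      "\<forall>f\<in>C0 (psi_space \<A>). \<forall>A. A \<notin> B \<union> C \<longrightarrow> (S + T) f (Ypt A) = 0" by auto
    moreover have "S + T \<in> bounded_ops (psi_space \<A>)"
      using S T by (auto simp: countable_range_ops_def bounded_ops_add)
    ultimately show "S + T \<in> countable_range_ops \<A>"
      unfolding countable_range_ops_def by blast
  qed
qed

text \<open>The countable sets belonging to a sequence of approximants have a countable union, and
  evaluation at a point is continuous. The extension along finite codimension relies on this
  closedness.\<close>

lemma countable_range_ops_closed:
  fixes T :: "(psi_point, 'k::real_normed_field) operator"
  assumes T: "T \<in> bounded_ops (psi_space \<A>)"
    and app: "\<And>e. e > 0 \<Longrightarrow> \<exists>S\<in>countable_range_ops \<A>. op_norm (psi_space \<A>) (T - S) < e"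
  shows "T \<in> countable_range_ops \<A>"
proof -
  let ?K = "psi_space \<A>"
  have "\<forall>n. \<exists>S B. S \<in> bounded_ops ?K \<and> op_norm ?K (T - S) < inverse (real (Suc n)) \<and>
      countable B \<and> (\<forall>f\<in>C0 ?K. \<forall>A. A \<notin> B \<longrightarrow> S f (Ypt A) = 0)"
  proof
    fix n
    obtain S where "S \<in> countable_range_ops \<A>" "op_norm ?K (T - S) < inverse (real (Suc n))"
      using app[of "inverse (real (Suc n))"] by auto
    then show "\<exists>S B. S \<in> bounded_ops ?K \<and> op_norm ?K (T - S) < inverse (real (Suc n)) \<and>
      countable B \<and> (\<forall>f\<in>C0 ?K. \<forall>A. A \<notin> B \<longrightarrow> S f (Ypt A) = 0)"
      unfolding countable_range_ops_def by blast
  qed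
  then obtain S B where S: "\<And>n. S n \<in> bounded_ops ?K"
      "\<And>n. op_norm ?K (T - S n) < inverse (real (Suc n))"
    and B: "\<And>n. countable (B n)" "\<And>n f A. f \<in> C0 ?K \<Longrightarrow> A \<notin> B n \<Longrightarrow> S n f (Ypt A) = 0"
    by metis
  have "T f (Ypt A) = 0" if f: "f \<in> C0 ?K" and A: "A \<notin> (\<Union>n. B n)" for f A
  proof -
    have le: "norm (T f (Ypt A)) \<le> inverse (real (Suc n)) * sup_norm ?K f" for n
    proof -
      have TS: "T - S n \<in> bounded_ops ?K" by (simp add: bounded_ops_diff T S(1))
      have "norm ((T - S n) f (Ypt A)) \<le> op_norm ?K (T - S n) * sup_norm ?K f"
        using norm_le_sup_norm_everywhere[OF _ bounded_ops_C0[OF TS f], of "Ypt A"]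
          sup_norm_le_op_norm_mult[OF _ TS f] by simp
      also have "\<dots> \<le> inverse (real (Suc n)) * sup_norm ?K f"
        using S(2)[of n] sup_norm_nonneg[OF _ f] by (intro mult_right_mono) auto
      finally show ?thesis using B(2)[OF f, of A n] A by simp
    qed
    have "(\<lambda>n. inverse (real (Suc n)) * sup_norm ?K f) \<longlonglongrightarrow> 0 * sup_norm ?K f"
      by (intro tendsto_intros LIMSEQ_inverse_real_of_nat)
    then have "norm (T f (Ypt A)) \<le> 0 * sup_norm ?K f"
      using le by (intro LIMSEQ_le_const) auto
    then show ?thesis by simp
  qed
  moreover have "countable (\<Union>n. B n)" using B(1) by auto
  ultimately show ?thesis using T unfolding countable_range_ops_def by blast
qed

section \<open>Automatic continuity\<close>

text \<open>The witnesses are rescaled by real factors only, so homogeneity is assumed in a form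
  that covers real and complex homomorphisms alike.\<close>

lemma hom_bounded_on_countable_range_ops:
  fixes \<A> :: "nat set set"
    and \<theta> :: "(psi_point, 'k::real_normed_field) operator \<Rightarrow> 'b::real_normed_algebra"
  assumes inf: "\<forall>A\<in>\<A>. infinite A"
    and ad: "pairwise (\<lambda>A A'. finite (A \<inter> A')) \<A>"
  defines "K \<equiv> psi_space \<A>"
  assumes add: "\<And>S T. S \<in> bounded_ops K \<Longrightarrow> T \<in> bounded_ops K \<Longrightarrow> \<theta> (S + T) = \<theta> S + \<theta> T"
    and scale: "\<And>r T. T \<in> bounded_ops K \<Longrightarrow> \<theta> (op_scale (of_real r) T) = r *\<^sub>R \<theta> T"
    and mult: "\<And>S T. S \<in> bounded_ops K \<Longrightarrow> T \<in> bounded_ops K \<Longrightarrow> \<theta> (S \<circ> T) = \<theta> S * \<theta> T"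
  shows "\<exists>C\<ge>0. \<forall>T\<in>countable_range_ops \<A>. norm (\<theta> T) \<le> C * op_norm K T"
proof (rule ccontr)
  assume contra: "\<not> ?thesis"
  have K: "topspace K \<noteq> {}" by (simp add: K_def)
  have "\<forall>n. \<exists>T B. T \<in> bounded_ops K \<and> norm (\<theta> T) > real n * op_norm K T \<and>
      countable B \<and> (\<forall>f\<in>C0 K. \<forall>A. A \<notin> B \<longrightarrow> T f (Ypt A) = 0)"
  proof
    fix n
    obtain T where "T \<in> countable_range_ops \<A>" "norm (\<theta> T) > real n * op_norm K T"
      using contra by (meson not_le of_nat_0_le_iff)
    then show "\<exists>T B. T \<in> bounded_ops K \<and> norm (\<theta> T) > real n * op_norm K T \<and>
      countable B \<and> (\<forall>f\<in>C0 K. \<forall>A. A \<notin> B \<longrightarrow> T f (Ypt A) = 0)"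
      unfolding countable_range_ops_def K_def by blast
  qed
  then obtain T B where T: "\<And>n. T n \<in> bounded_ops K"
      "\<And>n. norm (\<theta> (T n)) > real n * op_norm K (T n)"
    and B: "\<And>n. countable (B n)" "\<And>n f A. f \<in> C0 K \<Longrightarrow> A \<notin> B n \<Longrightarrow> T n f (Ypt A) = 0"
    by metis
  \<comment> \<open>All functions are \<open>0\<close> at \<open>Ypt A\<close> for
    \<open>A \<notin> \<A>\<close>, so the union can be cut down to a subfamily of
    \<open>\<A>\<close>, as the row operators require.\<close>
  define B' where "B' = (\<Union>n. B n) \<inter> \<A>"
  have B': "countable B'" "B' \<subseteq> \<A>" using B(1) by (auto simp: B'_def)
  have TB': "T n f (Ypt A) = 0" if f: "f \<in> C0 K" and "A \<notin> B'" for n f A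
  proof (cases "A \<in> \<A>")
    case True
    then show ?thesis using that B(2) by (auto simp: B'_def)
  next
    case False
    then show ?thesis
      using C0_psi_space_Ypt_outside[OF bounded_ops_C0[OF T(1) f, unfolded K_def]] by blast
  qed
  obtain Q :: "nat \<Rightarrow> (psi_point, 'k) operator" where Q: "\<And>n. Q n \<in> bounded_ops K"
    and row: "\<And>T. (\<And>n. T n \<in> bounded_ops K) \<Longrightarrow> (\<lambda>n. op_norm K (T n)) \<longlonglongrightarrow> 0 \<Longrightarrow>
      (\<And>n f A. f \<in> C0 K \<Longrightarrow> A \<notin> B' \<Longrightarrow> T n f (Ypt A) = 0) \<Longrightarrow>
      \<exists>S\<in>bounded_ops K. \<forall>n. Q n \<circ> S = T n"
    unfolding K_def by (rule row_operators[OF inf ad B']) blast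
  have pos: "op_norm K (T n) > 0" for n
  proof (rule ccontr)
    assume "\<not> op_norm K (T n) > 0"
    then have "T n = 0" using op_norm_eq_0[OF K T(1)] by simp
    moreover have "\<theta> 0 = 0" using add[OF bounded_ops_zero_op[OF K] bounded_ops_zero_op[OF K]] by simp
    ultimately show False
      using T(2)[of n] op_norm_nonneg[OF K T(1)[of n]] by (simp add: mult_less_0_iff)
  qed
  \<comment> \<open>The index is so large that, after \<open>s n\<close> scales the norm of the
    witness \<open>T (m n)\<close> to 1/(n+1), its image still has norm above n (1 + |\<theta>(Q
    n)|).\<close>
  define m where "m n = nat \<lceil>real (Suc n) * real n * (1 + norm (\<theta> (Q n)))\<rceil>" for n
  define s where "s n = inverse (real (Suc n) * op_norm K (T (m n)))" for n
  have s: "s n > 0" for n using pos by (simp add: s_def)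
  have s_norm: "s n * op_norm K (T (m n)) = inverse (real (Suc n))" for n
    using pos[of "m n"] by (simp add: s_def)
  define R where "R n = op_scale (of_real (s n)) (T (m n))" for n
  have R: "R n \<in> bounded_ops K" for n
    unfolding R_def by (rule bounded_ops_scale[OF K T(1)])
  have "op_norm K (R n) \<le> inverse (real (Suc n))" for n
    using op_norm_scale_le[OF K T(1), of "of_real (s n)" "m n"] s[of n] s_norm[of n]
    by (simp add: R_def)
  then have "(\<lambda>n. op_norm K (R n)) \<longlonglongrightarrow> 0"
    using op_norm_nonneg[OF K R]
    by (intro tendsto_sandwich[OF _ _ tendsto_const LIMSEQ_inverse_real_of_nat]) auto
  moreover have "R n f (Ypt A) = 0" if "f \<in> C0 K" "A \<notin> B'" for n f A
    using TB'[OF that] by (simp add: R_def op_scale_def)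
  ultimately obtain S where S: "S \<in> bounded_ops K" "\<And>n. Q n \<circ> S = R n"
    using row[of R] R by blast
  have "real n < norm (\<theta> S)" for n
  proof -
    \<comment> \<open>The summand \<open>1\<close> keeps this factor positive when
      \<open>\<theta> (Q n) = 0\<close>, so that it can be cancelled at the end.\<close>
    let ?q = "1 + norm (\<theta> (Q n))"
    have q: "?q > 0" by (simp add: add_pos_nonneg)
    have "real n * ?q = (s n * op_norm K (T (m n))) * (real (Suc n) * real n * ?q)"
      unfolding s_norm by (simp add: field_simps)
    also have "\<dots> \<le> (s n * op_norm K (T (m n))) * real (m n)"
      using s[of n] pos[of "m n"] by (intro mult_left_mono) (auto simp: m_def)
    also have "\<dots> < s n * norm (\<theta> (T (m n)))"
      using mult_strict_left_mono[OF T(2)[of "m n"] s[of n]] by (simp add: mult_ac)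
    also have "\<dots> = norm (\<theta> (R n))"
      using scale[OF T(1)[of "m n"], of "s n"] s[of n] by (simp add: R_def)
    also have "\<dots> \<le> norm (\<theta> (Q n)) * norm (\<theta> S)"
      using mult[OF Q S(1), of n] S(2)[of n] norm_mult_ineq by metis
    also have "\<dots> \<le> ?q * norm (\<theta> S)"
      by (intro mult_right_mono) auto
    finally show ?thesis using q by (simp add: mult.commute)
  qed
  then show False using reals_Archimedean2[of "norm (\<theta> S)"] less_asym by blast
qed

section \<open>From a norm bound to continuity of the homomorphism\<close>

lemma continuous_map_op_topology:
  fixes \<theta> :: "('p, 'k::real_normed_field) operator \<Rightarrow> 'b::real_normed_vector"
  assumes K: "topspace K \<noteq> {}"
    and add: "\<And>S T. S \<in> bounded_ops K \<Longrightarrow> T \<in> bounded_ops K \<Longrightarrow> \<theta> (S + T) = \<theta> S + \<theta> T"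
    and bound: "C \<ge> 0" "\<And>T. T \<in> bounded_ops K \<Longrightarrow> norm (\<theta> T) \<le> C * op_norm K T"
  shows "continuous_map (op_topology K) euclidean \<theta>"
proof -
  interpret Metric_space "bounded_ops K :: ('p, 'k) operator set" "op_dist K"
    by (rule Metric_space_bounded_ops[OF K])
  have "openin mtopology {T \<in> topspace mtopology. \<theta> T \<in> U}" if U: "open U" for U
    unfolding openin_mtopology
  proof (intro conjI allI impI)
    fix T assume "T \<in> {T \<in> topspace mtopology. \<theta> T \<in> U}"
    then have T: "T \<in> bounded_ops K" "\<theta> T \<in> U" by auto
    obtain e where e: "e > 0" "\<And>y. dist y (\<theta> T) < e \<Longrightarrow> y \<in> U"
      using U T(2) unfolding open_dist by blast
    \<comment> \<open>The radius has \<open>C + 1\<close> in place of \<open>C\<close> because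
      \<open>C\<close> may be \<open>0\<close>.\<close>
    have "mball T (e / (C + 1)) \<subseteq> {T \<in> topspace mtopology. \<theta> T \<in> U}"
    proof
      fix S assume "S \<in> mball T (e / (C + 1))"
      then have S: "S \<in> bounded_ops K" and lt: "op_norm K (S - T) < e / (C + 1)"
        using commute[of T S] T by (auto simp: op_dist_def)
      have ST: "S - T \<in> bounded_ops K" by (rule bounded_ops_diff[OF K S T(1)])
      have "\<theta> S = \<theta> (S - T) + \<theta> T" using add[OF ST T(1)] by simp
      then have "dist (\<theta> S) (\<theta> T) = norm (\<theta> (S - T))" by (simp add: dist_norm)
      also have "\<dots> \<le> (C + 1) * op_norm K (S - T)"
        using bound(2)[OF ST] op_norm_nonneg[OF K ST] by (simp add: algebra_simps)
      also have "\<dots> < e" using lt bound(1) by (simp add: field_simps)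
      finally show "S \<in> {T \<in> topspace mtopology. \<theta> T \<in> U}" using e(2) S by simp
    qed
    moreover have "e / (C + 1) > 0" using e(1) bound(1) by simp
    ultimately show "\<exists>r>0. mball T r \<subseteq> {T \<in> topspace mtopology. \<theta> T \<in> U}" by blast
  qed auto
  then show ?thesis
    by (auto simp: continuous_map_def op_topology_def)
qed

text \<open>The closed subspace \<open>countable_range_ops \<A>\<close> contains the operators with
  separable range, so it inherits finite codimension, and the bound on it spreads to all bounded
  operators. The scalar field and \<open>scl\<close> stay abstract so that the real and the complex
  case are both instances.\<close>

lemma hom_continuous:
  fixes \<A> :: "nat set set"
    and \<theta> :: "(psi_point, 'k::{real_normed_field, complete_space}) operator \<Rightarrow> 'b::real_normed_algebra"
  assumes inf: "\<forall>A\<in>\<A>. infinite A"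
    and ad: "pairwise (\<lambda>A A'. finite (A \<inter> A')) \<A>"
    and codim: "finite_codim op_scale (separable_range_ops (psi_space \<A>))
      (bounded_ops (psi_space \<A>) :: (psi_point, 'k) operator set)"
    and hom: "algebra_hom (psi_space \<A>) scl \<theta>"
    and norm_scl: "\<And>c x. norm (scl c x) = norm c * norm x"
    and scl_of_real: "\<And>r x. scl (of_real r) x = r *\<^sub>R x"
  shows "continuous_map (op_topology (psi_space \<A>)) euclidean \<theta>"
proof -
  let ?K = "psi_space \<A>"
  let ?V = "bounded_ops ?K :: (psi_point, 'k) operator set"
  interpret vector_space "op_scale :: 'k \<Rightarrow> (psi_point, 'k) operator \<Rightarrow> _"
    by (rule vector_space_op_scale)
  have V: "subspace ?V"
    by (rule subspaceI) (simp_all add: bounded_ops_zero_op bounded_ops_add bounded_ops_scale)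
  have \<theta>: "\<And>S T. S \<in> ?V \<Longrightarrow> T \<in> ?V \<Longrightarrow> \<theta> (S + T) = \<theta> S + \<theta> T"
    "\<And>c T. T \<in> ?V \<Longrightarrow> \<theta> (op_scale c T) = scl c (\<theta> T)"
    "\<And>S T. S \<in> ?V \<Longrightarrow> T \<in> ?V \<Longrightarrow> \<theta> (S \<circ> T) = \<theta> S * \<theta> T"
    using hom by (auto simp: algebra_hom_def)
  obtain B where B: "finite B" "B \<subseteq> ?V"
    "\<forall>v\<in>?V. \<exists>u\<in>span B. v - u \<in> separable_range_ops ?K"
    using codim unfolding finite_codim_def by blast
  have "\<exists>C\<ge>0. \<forall>T\<in>?V. norm (\<theta> T) \<le> C * op_norm ?K T"
  proof (rule seminorm_bound_finite_codim[OF vector_space_op_scale V, where W = "countable_range_ops \<A>"])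
    show "countable_range_ops \<A> \<subseteq> ?V" by (auto simp: countable_range_ops_def)
    show "\<forall>v\<in>?V. \<exists>u\<in>span B. v - u \<in> countable_range_ops \<A>"
      using B(3) separable_range_subset_countable_range by blast
    show "\<exists>C\<ge>0. \<forall>T\<in>countable_range_ops \<A>. norm (\<theta> T) \<le> C * op_norm ?K T"
      using hom_bounded_on_countable_range_ops[OF inf ad, of \<theta>] \<theta> by (simp add: scl_of_real)
  qed (use B \<theta> in \<open>simp_all add: op_norm_add_le op_norm_scale_le op_norm_nonneg norm_triangle_ineq
      norm_scl countable_range_ops_subspace countable_range_ops_closed\<close>)
  then obtain C where "C \<ge> 0" "\<And>T. T \<in> ?V \<Longrightarrow> norm (\<theta> T) \<le> C * op_norm ?K T" by blast
  then show ?thesis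
    using \<theta>(1) by (intro continuous_map_op_topology) auto
qed

theorem corollary39:
  fixes \<A> :: "nat set set"
  assumes "\<forall>A\<in>\<A>. infinite A"
    and "pairwise (\<lambda>A A'. finite (A \<inter> A')) \<A>"
  shows
    "(finite_codim op_scale (separable_range_ops (psi_space \<A>))
        (bounded_ops (psi_space \<A>) :: (psi_point, real) operator set) \<longrightarrow>
      (\<forall>\<theta> :: (psi_point, real) operator \<Rightarrow> 'b::{real_normed_algebra, banach}.
         algebra_hom (psi_space \<A>) scaleR \<theta> \<longrightarrow>
         continuous_map (op_topology (psi_space \<A>)) euclidean \<theta>))
     \<and>
     (finite_codim op_scale (separable_range_ops (psi_space \<A>))
        (bounded_ops (psi_space \<A>) :: (psi_point, complex) operator set) \<longrightarrow>
      (\<forall>scl :: complex \<Rightarrow> 'c::{real_normed_algebra, banach} \<Rightarrow> 'c.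
         complex_banach_algebra scl \<longrightarrow>
         (\<forall>\<theta> :: (psi_point, complex) operator \<Rightarrow> 'c.
            algebra_hom (psi_space \<A>) scl \<theta> \<longrightarrow>
            continuous_map (op_topology (psi_space \<A>)) euclidean \<theta>)))"
proof (intro conjI impI allI)
  fix \<theta> :: "(psi_point, real) operator \<Rightarrow> 'b"
  assume "finite_codim op_scale (separable_range_ops (psi_space \<A>))
      (bounded_ops (psi_space \<A>) :: (psi_point, real) operator set)"
    and "algebra_hom (psi_space \<A>) scaleR \<theta>"
  then show "continuous_map (op_topology (psi_space \<A>)) euclidean \<theta>"
    by (rule hom_continuous[OF assms]) simp_all
next
  fix scl :: "complex \<Rightarrow> 'c \<Rightarrow> 'c" and \<theta> :: "(psi_point, complex) operator \<Rightarrow> 'c"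
  assume "complex_banach_algebra scl"
  then interpret complex_banach_algebra scl .
  assume "finite_codim op_scale (separable_range_ops (psi_space \<A>))
      (bounded_ops (psi_space \<A>) :: (psi_point, complex) operator set)"
    and "algebra_hom (psi_space \<A>) scl \<theta>"
  then show "continuous_map (op_topology (psi_space \<A>)) euclidean \<theta>"
    by (rule hom_continuous[OF assms]) (simp_all add: norm_scale scale_of_real)
qed

end
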